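(* For every integer $k\ge 0$, let $v_{k+\frac12}=\sum_\mu a_{k+\frac12}(\mu) f^\mu$, where the sum is over all integer partitions $\mu$. Then $v_{k+\frac12}$ is the number of each of the following structures: (a) cyclically ordered set partitions of $[k+1]$; (b) set partitions of $[k+1]$ together with a linear order on all the blocks except the block containing $k+1$.
   Context: $[k]=\{1,2,\dots,k\}$. Integer partitions are identified with their Young diagrams and ordered by containment; $\emptyset$ is the only partition of $0$. $f^\mu$ is the number of standard Young tableaux of shape $\mu$, with $f^\emptyset=1$. A limiting vacillating tableau of shape $\mu$ and length $2k+1$ is a sequence of $2k+2$ integer partitions $(\mu^{(0)}=\emptyset,\mu^{(1/2)},\mu^{(1)},\dots,\mu^{(k)},\mu^{(k+1/2)}=\mu)$ such that (a) for each integer $j=0,\dots,k$: $\mu^{(j)}\supseteq\mu^{(j+1/2)}$ and $|\mu^{(j)}/\mu^{(j+1/2)}|\in\{0,1\}$; (b) for each integer $j=0,\dots,k-1$: $\mu^{(j+1/2)}\subseteq\mu^{(j+1)}$ and $|\mu^{(j+1)}/\mu^{(j+1/2)}|=1$. $a_{k+\frac12}(\mu)$ is the number of limiting vacillating tableaux of shape $\mu$ and length $2k+1$. A cyclically ordered set partition of a set $S$ is a set partition of $S$ together with a cyclic ordering of its blocks (linear orderings of the blocks considered up to cyclic rotation, so that there are $j!$ cyclic orderings of $j+1$ blocks). *)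

theory Defs
  imports
    "HOL-Library.FuncSet"
    "HOL-Library.Disjoint_Sets"
    "HOL-Combinatorics.Multiset_Permutations"
begin

section \<open>Integer partitions and Young diagrams\<close>

text \<open>An integer partition is the weakly decreasing list of its parts, all of them positive;
  the empty list is the only partition of 0.\<close>

definition int_partition :: "nat list \<Rightarrow> bool" where
  "int_partition \<mu> \<longleftrightarrow> sorted_wrt (\<ge>) \<mu> \<and> 0 \<notin> set \<mu>"

text \<open>Cells are pairs (row, column), both counted from 0.\<close>

definition young_diagram :: "nat list \<Rightarrow> (nat \<times> nat) set" where
  "young_diagram \<mu> = {(i, j). i < length \<mu> \<and> j < \<mu> ! i}"

text \<open>A standard Young tableau is a filling of the diagram with \<open>1, \<dots>, |\<mu>|\<close>, each used once,
  that increases along rows and columns. Fillings are extensional (\<open>undefined\<close> off the diagram),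
  so that distinct functions are distinct tableaux.\<close>

definition standard_young_tableaux :: "nat list \<Rightarrow> (nat \<times> nat \<Rightarrow> nat) set" where
  "standard_young_tableaux \<mu> =
    {T \<in> extensional (young_diagram \<mu>).
       bij_betw T (young_diagram \<mu>) {1..sum_list \<mu>} \<and>
       (\<forall>i j j'. (i, j') \<in> young_diagram \<mu> \<and> j < j' \<longrightarrow> T (i, j) < T (i, j')) \<and>
       (\<forall>i i' j. (i', j) \<in> young_diagram \<mu> \<and> (i, j) \<in> young_diagram \<mu> \<and> i < i' \<longrightarrow>
          T (i, j) < T (i', j))}"

definition num_SYT :: "nat list \<Rightarrow> nat" where
  "num_SYT \<mu> = card (standard_young_tableaux \<mu>)"


section \<open>Limiting vacillating tableaux\<close>

text \<open>A tableau of length \<open>2k+1\<close> is a list of \<open>2k+2\<close> partitions; its entry at position \<open>i\<close> is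
  \<open>\<mu>\<^sup>(\<^sup>i\<^sup>/\<^sup>2\<^sup>)\<close>. Thus the integer index \<open>j\<close> sits at position \<open>2*j\<close> and the half-integer index
  \<open>j + 1/2\<close> at position \<open>2*j + 1\<close>.\<close>

definition limiting_vacillating_tableaux :: "nat \<Rightarrow> nat list \<Rightarrow> nat list list set" where
  "limiting_vacillating_tableaux k \<mu> =
    {M. length M = 2 * k + 2 \<and> (\<forall>\<nu>\<in>set M. int_partition \<nu>) \<and>
        M ! 0 = [] \<and> M ! (2 * k + 1) = \<mu> \<and>
        (\<forall>j\<le>k. young_diagram (M ! (2 * j + 1)) \<subseteq> young_diagram (M ! (2 * j)) \<and>
               card (young_diagram (M ! (2 * j)) - young_diagram (M ! (2 * j + 1))) \<in> {0, 1}) \<and>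
        (\<forall>j<k. young_diagram (M ! (2 * j + 1)) \<subseteq> young_diagram (M ! (2 * j + 2)) \<and>
               card (young_diagram (M ! (2 * j + 2)) - young_diagram (M ! (2 * j + 1))) = 1)}"

text \<open>The number \<open>a\<close> with index \<open>k + 1/2\<close>, and likewise \<open>v\<close> below.\<close>

definition a_half :: "nat \<Rightarrow> nat list \<Rightarrow> nat" where
  "a_half k \<mu> = card (limiting_vacillating_tableaux k \<mu>)"

text \<open>The sum over all integer partitions, formed over its support, which is finite
  (lemma \<open>finite_support_a_half\<close> below).\<close>

definition v_half :: "nat \<Rightarrow> nat" where
  "v_half k = (\<Sum>\<mu> | int_partition \<mu> \<and> a_half k \<mu> \<noteq> 0. a_half k \<mu> * num_SYT \<mu>)"


section \<open>Set partitions with ordered blocks\<close>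

text \<open>Cyclic orderings of a finite set: its linear orderings, as duplicate-free lists,
  modulo rotation.\<close>

definition cyclic_orderings :: "'a set \<Rightarrow> 'a list set set" where
  "cyclic_orderings A = permutations_of_set A // {(xs, ys). \<exists>n. ys = rotate n xs}"

definition cyclically_ordered_set_partitions :: "'a set \<Rightarrow> ('a set set \<times> 'a set list set) set" where
  "cyclically_ordered_set_partitions S = (SIGMA P:{P. partition_on S P}. cyclic_orderings P)"

definition set_partitions_ordered_except :: "'a set \<Rightarrow> 'a \<Rightarrow> ('a set set \<times> 'a set rel) set" where
  "set_partitions_ordered_except S x =
    (SIGMA P:{P. partition_on S P}. {r. linear_order_on {B \<in> P. x \<notin> B} r})"


section \<open>Finiteness of the structures being counted\<close>

lemma young_diagram_Sigma: "young_diagram \<mu> = (SIGMA i:{..<length \<mu>}. {..<\<mu> ! i})"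
  by (auto simp: young_diagram_def)

lemma finite_young_diagram: "finite (young_diagram \<mu>)"
  by (simp add: young_diagram_Sigma)

lemma card_young_diagram: "card (young_diagram \<mu>) = sum_list \<mu>"
  by (simp add: young_diagram_Sigma sum_list_sum_nth atLeast0LessThan)

lemma finite_standard_young_tableaux: "finite (standard_young_tableaux \<mu>)"
proof (rule finite_subset)
  show "standard_young_tableaux \<mu> \<subseteq> young_diagram \<mu> \<rightarrow>\<^sub>E {1..sum_list \<mu>}"
    by (auto simp: standard_young_tableaux_def PiE_def bij_betw_def)
qed (simp add: finite_PiE finite_young_diagram)

lemma length_le_sum_list: "0 \<notin> set \<mu> \<Longrightarrow> length \<mu> \<le> sum_list (\<mu> :: nat list)"
  by (induction \<mu>) auto

lemma finite_int_partitions_le: "finite {\<mu>. int_partition \<mu> \<and> sum_list \<mu> \<le> n}"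
proof (rule finite_subset)
  show "{\<mu>. int_partition \<mu> \<and> sum_list \<mu> \<le> n} \<subseteq> {\<mu>. set \<mu> \<subseteq> {..n} \<and> length \<mu> \<le> n}"
  proof clarify
    fix \<mu> :: "nat list" assume "int_partition \<mu>" and le: "sum_list \<mu> \<le> n"
    then have "length \<mu> \<le> n"
      using length_le_sum_list[of \<mu>] by (simp add: int_partition_def)
    moreover have "x \<le> n" if "x \<in> set \<mu>" for x
      using member_le_sum_list[OF that] le by simp
    ultimately show "set \<mu> \<subseteq> {..n} \<and> length \<mu> \<le> n"
      by blast
  qed
qed (simp add: finite_lists_length_le)

lemma limiting_vacillating_tableau_size:
  assumes M: "M \<in> limiting_vacillating_tableaux k \<mu>"
  shows "j \<le> k \<Longrightarrow> sum_list (M ! (2 * j)) \<le> j \<and> sum_list (M ! (2 * j + 1)) \<le> j"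
proof (induction j)
  case 0
  have start: "M ! 0 = []"
    using M by (simp add: limiting_vacillating_tableaux_def)
  have "young_diagram (M ! (2 * 0 + 1)) \<subseteq> young_diagram (M ! (2 * 0))"
    using M unfolding limiting_vacillating_tableaux_def by blast
  then have "sum_list (M ! (2 * 0 + 1)) \<le> sum_list (M ! (2 * 0))"
    using card_mono[OF finite_young_diagram] by (metis card_young_diagram)
  then show ?case
    using start by simp
next
  case (Suc j)
  let ?A = "M ! (2 * j + 1)" and ?B = "M ! (2 * j + 2)" and ?C = "M ! (2 * Suc j + 1)"
  have "j < k"
    using Suc.prems by simp
  then have "young_diagram ?A \<subseteq> young_diagram ?B"
    and "card (young_diagram ?B - young_diagram ?A) = 1"
    using M unfolding limiting_vacillating_tableaux_def by blast+
  then have "sum_list ?B - sum_list ?A = 1"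
    by (metis card_Diff_subset card_young_diagram finite_young_diagram)
  then have "sum_list ?B \<le> Suc j"
    using Suc by linarith
  moreover have "young_diagram ?C \<subseteq> young_diagram (M ! (2 * Suc j))"
    using M Suc.prems unfolding limiting_vacillating_tableaux_def by blast
  then have "sum_list ?C \<le> sum_list (M ! (2 * Suc j))"
    using card_mono[OF finite_young_diagram] by (metis card_young_diagram)
  ultimately show ?case
    by simp
qed

lemma finite_limiting_vacillating_tableaux: "finite (limiting_vacillating_tableaux k \<mu>)"
proof (rule finite_subset)
  let ?P = "{\<nu>. int_partition \<nu> \<and> sum_list \<nu> \<le> k}"
  show "limiting_vacillating_tableaux k \<mu> \<subseteq> {M. set M \<subseteq> ?P \<and> length M = 2 * k + 2}"
  proof clarify
    fix M assume M: "M \<in> limiting_vacillating_tableaux k \<mu>"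
    then have len: "length M = 2 * k + 2" and part: "\<forall>\<nu>\<in>set M. int_partition \<nu>"
      by (auto simp: limiting_vacillating_tableaux_def)
    have "sum_list (M ! i) \<le> k" if "i < length M" for i
    proof -
      have "i div 2 \<le> k" and "i = 2 * (i div 2) \<or> i = 2 * (i div 2) + 1"
        using that len by auto
      then show ?thesis
        using limiting_vacillating_tableau_size[OF M, of "i div 2"] by (metis order_trans)
    qed
    then show "set M \<subseteq> ?P \<and> length M = 2 * k + 2"
      using len part by (auto simp: in_set_conv_nth)
  qed
qed (intro finite_lists_length_eq finite_int_partitions_le)

lemma finite_support_a_half: "finite {\<mu>. int_partition \<mu> \<and> a_half k \<mu> \<noteq> 0}"
proof (rule finite_subset)
  show "{\<mu>. int_partition \<mu> \<and> a_half k \<mu> \<noteq> 0} \<subseteq> {\<mu>. int_partition \<mu> \<and> sum_list \<mu> \<le> k}"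
  proof clarify
    fix \<mu> assume "0 < a_half k \<mu>"
    then obtain M where M: "M \<in> limiting_vacillating_tableaux k \<mu>"
      by (auto simp: a_half_def card_gt_0_iff)
    then show "sum_list \<mu> \<le> k"
      using limiting_vacillating_tableau_size[OF M, of k]
      by (simp add: limiting_vacillating_tableaux_def)
  qed
qed (rule finite_int_partitions_le)

lemma finite_cyclically_ordered_set_partitions:
  assumes "finite S"
  shows "finite (cyclically_ordered_set_partitions S)"
  unfolding cyclically_ordered_set_partitions_def
proof (rule finite_SigmaI)
  show "finite {P. partition_on S P}"
    using assms by (rule finitely_many_partition_on)
  show "finite (cyclic_orderings P)" for P :: "'a set set"
    by (cases "finite P") (simp_all add: cyclic_orderings_def quotient_def permutations_of_set_infinite)
qed

lemma finite_set_partitions_ordered_except: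
  assumes "finite S"
  shows "finite (set_partitions_ordered_except S x)"
  unfolding set_partitions_ordered_except_def
proof (rule finite_SigmaI)
  show "finite {P. partition_on S P}"
    using assms by (rule finitely_many_partition_on)
  fix P assume "P \<in> {P. partition_on S P}"
  then have "finite P"
    using assms finite_elements by blast
  then have "finite (Pow ({B \<in> P. x \<notin> B} \<times> {B \<in> P. x \<notin> B}))"
    by simp
  moreover have "{r. linear_order_on {B \<in> P. x \<notin> B} r} \<subseteq> Pow ({B \<in> P. x \<notin> B} \<times> {B \<in> P. x \<notin> B})"
    unfolding order_on_defs by blast
  ultimately show "finite {r. linear_order_on {B \<in> P. x \<notin> B} r}"
    by (rule rev_finite_subset)
qed

end

theory Submission
  imports Defs
begin

text \<open>
  A limiting vacillating tableau is a walk in Young's lattice: starting from the empty partition it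
  alternates a step that keeps the partition or removes a cell with a step that adds a cell. Write \<open>f \<mu>\<close>
  for the number of standard Young tableaux of shape \<open>\<mu>\<close>. Two identities govern the sum of \<open>f\<close> over the
  end points of such walks. Removing the largest entry of a tableau gives

    \<open>f \<mu> = sum of f \<nu> over all \<nu> obtained from \<mu> by removing a cell\<close>   (\<open>\<mu>\<close> nonempty),

  and the commutation relation \<open>D U - U D = I\<close> for adding (\<open>U\<close>) and removing (\<open>D\<close>) cells, which expresses
  that every diagram has one more outer corner than inner corners, gives by induction

    \<open>sum of f \<mu> over all \<mu> obtained from \<nu> by adding a cell = (n + 1) * f \<nu>\<close>   where \<open>n\<close> is the size of \<open>\<nu>\<close>

  (\<open>num_fillings_rec\<close> and \<open>sum_num_fillings_outer\<close>). Hence each step acts on weights of the form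
  \<open>f \<mu> * g |\<mu>|\<close> through \<open>g\<close> alone: if \<open>L k g\<close> denotes the sum of these weights over the end points of all
  tableaux of length \<open>2k + 1\<close>, then \<open>L (k + 1) g = L k h\<close> with \<open>h m = (m + 1) * (g m + g (m + 1))\<close>.

  The sum of \<open>(|P| - 1)! * g (|P| - 1)\<close> over the set partitions \<open>P\<close> of \<open>[k + 1]\<close> obeys the same recursion,
  since the element \<open>k + 2\<close> is put into one of the existing blocks or into a block of its own
  (\<open>sum_partitions_insert\<close>). Both start with \<open>g 0\<close>, so they agree; at \<open>g = 1\<close> this says that \<open>v_half k\<close>
  is the sum of \<open>(|P| - 1)!\<close> over all \<open>P\<close>. Finally \<open>(|P| - 1)!\<close> is the number of cyclic orderings of the
  blocks of \<open>P\<close> (\<open>card_cyclic_orderings\<close>), and also the number of linear orders on the blocks other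
  than the one that contains \<open>k + 1\<close> (\<open>card_linear_orders\<close>).
\<close>

section \<open>Shapes and their corners\<close>

text \<open>Finite down-closed sets of cells are exactly the Young diagrams. Working with them instead of
  with lists of parts turns adding and removing a cell into set operations, and makes unions and
  intersections of diagrams again diagrams.\<close>

definition shape :: "(nat \<times> nat) set \<Rightarrow> bool" where
  "shape X \<longleftrightarrow> finite X \<and> (\<forall>i j i' j'. (i, j) \<in> X \<and> i' \<le> i \<and> j' \<le> j \<longrightarrow> (i', j') \<in> X)"

definition row_length :: "(nat \<times> nat) set \<Rightarrow> nat \<Rightarrow> nat" where
  "row_length X i = card {j. (i, j) \<in> X}"

lemma shape_finite: "shape X \<Longrightarrow> finite X"
  by (simp add: shape_def)

lemma shapeD: "shape X \<Longrightarrow> (i, j) \<in> X \<Longrightarrow> i' \<le> i \<Longrightarrow> j' \<le> j \<Longrightarrow> (i', j') \<in> X"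
  unfolding shape_def by blast

lemma shape_Int: "shape X \<Longrightarrow> shape Y \<Longrightarrow> shape (X \<inter> Y)"
  unfolding shape_def by blast

lemma shape_Un: "shape X \<Longrightarrow> shape Y \<Longrightarrow> shape (X \<union> Y)"
  unfolding shape_def by (metis UnE UnI1 UnI2 finite_Un)

text \<open>Each row of a shape is an initial segment of the natural numbers, so a shape is determined
  by its row lengths.\<close>

lemma mem_shape_iff:
  assumes "shape X"
  shows "(i, j) \<in> X \<longleftrightarrow> j < row_length X i"
proof -
  let ?R = "{j. (i, j) \<in> X}"
  have fin: "finite ?R"
    using finite_vimageI[OF shape_finite[OF assms], of "Pair i"] by (simp add: vimage_def inj_on_def)
  have down: "j' \<in> ?R" if "j \<in> ?R" "j' \<le> j" for j j'
    using that shapeD[OF assms] by blast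
  show ?thesis
  proof
    assume "(i, j) \<in> X"
    then have "{..j} \<subseteq> ?R"
      using down by blast
    then show "j < row_length X i"
      using card_mono[OF fin, of "{..j}"] by (simp add: row_length_def)
  next
    assume "j < row_length X i"
    show "(i, j) \<in> X"
    proof (rule ccontr)
      assume "(i, j) \<notin> X"
      then have "?R \<subseteq> {..<j}"
        using down by (metis (mono_tags) lessThan_iff linorder_not_le mem_Collect_eq subsetI)
      then have "card ?R \<le> j"
        using card_mono[of "{..<j}" ?R] by simp
      then show False
        using \<open>j < row_length X i\<close> by (simp add: row_length_def)
    qed
  qed
qed

lemma row_length_antimono:
  assumes "shape X" "i \<le> i'"
  shows "row_length X i' \<le> row_length X i"
proof (rule ccontr)
  assume "\<not> ?thesis"
  then have "(i', row_length X i) \<in> X"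
    using mem_shape_iff[OF assms(1)] by simp
  then have "(i, row_length X i) \<in> X"
    using shapeD assms by blast
  then show False
    using mem_shape_iff[OF assms(1)] by simp
qed

lemma shapeI_row_lengths:
  assumes "finite X" "\<And>i j. (i, j) \<in> X \<longleftrightarrow> j < h i" "\<And>i. h (Suc i) \<le> h i"
  shows "shape X"
proof -
  have "h i \<le> h i'" if "i' \<le> i" for i i'
    using lift_Suc_antimono_le[of h] assms(3) that by blast
  then show ?thesis
    unfolding shape_def using assms(1,2) by (meson le_less_trans less_le_trans)
qed

lemma young_diagram_shape:
  assumes "int_partition \<mu>"
  shows "shape (young_diagram \<mu>)"
proof (rule shapeI_row_lengths)
  let ?h = "\<lambda>i. if i < length \<mu> then \<mu> ! i else 0"
  show "finite (young_diagram \<mu>)"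
    by (rule finite_young_diagram)
  show "(i, j) \<in> young_diagram \<mu> \<longleftrightarrow> j < ?h i" for i j
    by (simp add: young_diagram_def)
  show "?h (Suc i) \<le> ?h i" for i
    using assms by (auto simp: int_partition_def sorted_wrt_iff_nth_less)
qed

lemma row_length_young_diagram:
  "row_length (young_diagram \<mu>) i = (if i < length \<mu> then \<mu> ! i else 0)"
  by (auto simp: row_length_def young_diagram_def)

lemma bij_betw_young_diagram:
  "bij_betw young_diagram {\<mu>. int_partition \<mu>} {X. shape X}"
  unfolding bij_betw_def
proof (intro conjI subset_antisym)
  show "inj_on young_diagram {\<mu>. int_partition \<mu>}"
  proof (rule inj_onI, clarify)
    fix \<mu> \<nu> assume *: "int_partition \<mu>" "int_partition \<nu>" "young_diagram \<mu> = young_diagram \<nu>"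
    have pos: "\<mu> ! i > 0" if "i < length \<mu>" "int_partition \<mu>" for i \<mu>
      using that nth_mem[OF that(1)] by (cases "\<mu> ! i = 0") (auto simp: int_partition_def)
    have row: "(if i < length \<mu> then \<mu> ! i else 0) = (if i < length \<nu> then \<nu> ! i else 0)" for i
      using *(3) row_length_young_diagram by metis
    have "i < length \<mu> \<longleftrightarrow> i < length \<nu>" for i
      using row[of i] pos[of i] *(1,2) by (metis less_numeral_extra(3))
    then have "length \<mu> = length \<nu>"
      by (metis linorder_neqE_nat less_irrefl)
    then show "\<mu> = \<nu>"
      using row by (metis nth_equalityI)
  qed
  show "young_diagram ` {\<mu>. int_partition \<mu>} \<subseteq> {X. shape X}"
    using young_diagram_shape by blast
  show "{X. shape X} \<subseteq> young_diagram ` {\<mu>. int_partition \<mu>}"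
  proof clarify
    fix X assume X: "shape X"
    define h where "h = row_length X"
    define r where "r = card {i. (i, 0) \<in> X}"
    \<comment> \<open>The length of the first column, needed as the number of parts, is a row length of the conjugate shape.\<close>
    have "shape (prod.swap ` X)"
      unfolding shape_def using X shape_finite[OF X] by (auto dest: shapeD)
    note column = mem_shape_iff[OF this, of 0]
    have swap: "(0, i) \<in> prod.swap ` X \<longleftrightarrow> (i, 0) \<in> X" for i
      by force
    have "row_length (prod.swap ` X) 0 = r"
      unfolding r_def row_length_def swap ..
    then have r: "(i, 0) \<in> X \<longleftrightarrow> i < r" for i
      using column[of i] swap[of i] by metis
    have h: "h i > 0 \<longleftrightarrow> i < r" for i
      using r[of i] mem_shape_iff[OF X, of i 0] by (simp add: h_def)
    let ?\<mu> = "map h [0..<r]"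
    have "(i, j) \<in> young_diagram ?\<mu> \<longleftrightarrow> (i, j) \<in> X" for i j
      using mem_shape_iff[OF X, of i j] h[of i] by (auto simp: young_diagram_def h_def)
    then have "young_diagram ?\<mu> = X"
      by auto
    moreover have "int_partition ?\<mu>"
    proof -
      have "h i \<noteq> 0" if "i < r" for i
        using h[of i] that by simp
      then have "0 \<notin> set ?\<mu>"
        by force
      moreover have "sorted_wrt (\<ge>) ?\<mu>"
        using row_length_antimono[OF X] by (simp add: sorted_wrt_iff_nth_less h_def)
      ultimately show ?thesis
        by (simp add: int_partition_def)
    qed
    ultimately show "X \<in> young_diagram ` {\<mu>. int_partition \<mu>}"
      by blast
  qed
qed

definition outer_corners :: "(nat \<times> nat) set \<Rightarrow> (nat \<times> nat) set" where
  "outer_corners X = {c. c \<notin> X \<and> shape (insert c X)}"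

definition inner_corners :: "(nat \<times> nat) set \<Rightarrow> (nat \<times> nat) set" where
  "inner_corners X = {c \<in> X. shape (X - {c})}"

text \<open>In terms of row lengths, adding a cell raises one of them by 1; they remain decreasing if the
  row is the first one or strictly shorter than its predecessor.\<close>

lemma outer_corners_eq:
  assumes X: "shape X"
  shows "outer_corners X = (\<lambda>i. (i, row_length X i)) ` insert 0 (Suc ` {i. row_length X (Suc i) < row_length X i})"
    (is "_ = ?f ` ?I")
proof (intro subset_antisym subsetI)
  fix c assume "c \<in> outer_corners X"
  then obtain i j where c: "c = (i, j)" "(i, j) \<notin> X" and S: "shape (insert (i, j) X)"
    by (cases c) (auto simp: outer_corners_def)
  have "j' < row_length X i" if "j' < j" for j'
    using shapeD[OF S, of i j i j'] that mem_shape_iff[OF X] by auto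
  then have j: "j = row_length X i"
    using c(2) mem_shape_iff[OF X] by (meson nat_neq_iff)
  have "row_length X (Suc i') < row_length X i'" if "i = Suc i'" for i'
    using shapeD[OF S, of i j i' j] that mem_shape_iff[OF X] j by auto
  then have "i \<in> ?I"
    by (cases i) auto
  then show "c \<in> ?f ` ?I"
    using c(1) j by blast
next
  fix c assume "c \<in> ?f ` ?I"
  then obtain i where i: "i \<in> ?I" and c: "c = (i, row_length X i)"
    by blast
  have "shape (insert c X)"
  proof (rule shapeI_row_lengths)
    let ?h = "(row_length X)(i := Suc (row_length X i))"
    show "finite (insert c X)"
      using shape_finite[OF X] by simp
    show "(a, b) \<in> insert c X \<longleftrightarrow> b < ?h a" for a b
      using mem_shape_iff[OF X] c by auto
    show "?h (Suc a) \<le> ?h a" for a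
      using row_length_antimono[OF X, of a "Suc a"] i by auto
  qed
  then show "c \<in> outer_corners X"
    using mem_shape_iff[OF X] c by (simp add: outer_corners_def)
qed

lemma inner_corners_eq:
  assumes X: "shape X"
  shows "inner_corners X = (\<lambda>i. (i, row_length X i - 1)) ` {i. row_length X (Suc i) < row_length X i}"
    (is "_ = ?f ` ?I")
proof (intro subset_antisym subsetI)
  fix c assume "c \<in> inner_corners X"
  then obtain i j where c: "c = (i, j)" "(i, j) \<in> X" and S: "shape (X - {(i, j)})"
    by (cases c) (auto simp: inner_corners_def)
  have "(i, Suc j) \<notin> X" "(Suc i, j) \<notin> X"
    using shapeD[OF S, of i "Suc j" i j] shapeD[OF S, of "Suc i" j i j] by auto
  then have "j = row_length X i - 1" "i \<in> ?I"
    using c(2) mem_shape_iff[OF X] by auto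
  then show "c \<in> ?f ` ?I"
    using c(1) by blast
next
  fix c assume "c \<in> ?f ` ?I"
  then obtain i where i: "i \<in> ?I" and c: "c = (i, row_length X i - 1)"
    by blast
  have "shape (X - {c})"
  proof (rule shapeI_row_lengths)
    let ?h = "(row_length X)(i := row_length X i - 1)"
    show "finite (X - {c})"
      using shape_finite[OF X] by simp
    show "(a, b) \<in> X - {c} \<longleftrightarrow> b < ?h a" for a b
      using mem_shape_iff[OF X] c by auto
    show "?h (Suc a) \<le> ?h a" for a
      using row_length_antimono[OF X, of a "Suc a"] i by auto
  qed
  then show "c \<in> inner_corners X"
    using mem_shape_iff[OF X] c i by (auto simp: inner_corners_def)
qed

lemma finite_inner_corners: "shape X \<Longrightarrow> finite (inner_corners X)"
  by (simp add: inner_corners_def shape_finite)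

lemma finite_descents:
  assumes X: "shape X"
  shows "finite {i. row_length X (Suc i) < row_length X i}"
proof (rule finite_subset)
  show "{i. row_length X (Suc i) < row_length X i} \<subseteq> fst ` X"
    using mem_shape_iff[OF X] by (force simp: image_iff)
qed (simp add: shape_finite[OF X])

lemma finite_outer_corners: "shape X \<Longrightarrow> finite (outer_corners X)"
  by (simp add: outer_corners_eq finite_descents)

text \<open>Every strict descent from row \<open>i\<close> to row \<open>i + 1\<close> yields the inner corner that ends row \<open>i\<close> and
  the outer corner that extends row \<open>i + 1\<close>. The outer corner of row 0 is the only one that remains.\<close>

lemma card_outer_corners:
  assumes X: "shape X"
  shows "card (outer_corners X) = Suc (card (inner_corners X))"
proof -
  let ?I = "{i. row_length X (Suc i) < row_length X i}"
  have "card (outer_corners X) = card (insert 0 (Suc ` ?I))"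
    unfolding outer_corners_eq[OF X] by (rule card_image) (simp add: inj_on_def)
  also have "\<dots> = Suc (card ?I)"
    using finite_descents[OF X] by (simp add: card_image)
  also have "card ?I = card (inner_corners X)"
    unfolding inner_corners_eq[OF X] by (rule card_image[symmetric]) (simp add: inj_on_def)
  finally show ?thesis .
qed

section \<open>The two branching identities for standard tableaux\<close>

text \<open>Standard Young tableaux, indexed by their diagram instead of their list of parts.\<close>

definition standard_fillings :: "(nat \<times> nat) set \<Rightarrow> (nat \<times> nat \<Rightarrow> nat) set" where
  "standard_fillings X =
    {T \<in> extensional X. bij_betw T X {1..card X} \<and>
       (\<forall>i j j'. (i, j') \<in> X \<and> j < j' \<longrightarrow> T (i, j) < T (i, j')) \<and>
       (\<forall>i i' j. (i', j) \<in> X \<and> (i, j) \<in> X \<and> i < i' \<longrightarrow> T (i, j) < T (i', j))}"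

definition num_fillings :: "(nat \<times> nat) set \<Rightarrow> nat" where
  "num_fillings X = card (standard_fillings X)"

lemma num_SYT_eq_num_fillings: "num_SYT \<mu> = num_fillings (young_diagram \<mu>)"
  by (simp add: num_SYT_def num_fillings_def standard_young_tableaux_def standard_fillings_def
      card_young_diagram)

lemma finite_standard_fillings: "finite X \<Longrightarrow> finite (standard_fillings X)"
  by (rule finite_subset[OF _ finite_PiE[of X "\<lambda>_. {1..card X}"]])
    (auto simp: standard_fillings_def PiE_def bij_betw_def)

lemma num_fillings_empty: "num_fillings {} = 1"
proof -
  have "standard_fillings {} = {\<lambda>_. undefined}"
    by (auto simp: standard_fillings_def bij_betw_def)
  then show ?thesis
    by (simp add: num_fillings_def)
qed

text \<open>The two cells may differ in both coordinates; the comparison then goes through the cell \<open>(i, j')\<close>.\<close>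

lemma filling_less:
  assumes X: "shape X" and T: "T \<in> standard_fillings X" and "(i', j') \<in> X" "i \<le> i'" "j \<le> j'" "(i, j) \<noteq> (i', j')"
  shows "T (i, j) < T (i', j')"
proof -
  have row: "T (i, j) < T (i, j')" if "j < j'" 
    using T that shapeD[OF X assms(3,4) order.refl] unfolding standard_fillings_def by blast
  have col: "T (i, j') < T (i', j')" if "i < i'" 
    using T that assms(3) shapeD[OF X assms(3,4) order.refl] unfolding standard_fillings_def by blast
  show ?thesis
    using row col assms(4-6) by (cases "j < j'"; cases "i < i'") auto
qed

text \<open>The largest entry of a standard filling sits in an inner corner, and deleting it leaves a
  standard filling of the smaller shape.\<close>

lemma bij_betw_standard_fillings:
  assumes X: "shape X" and "X \<noteq> {}"
  shows "bij_betw (\<lambda>(c, T). T(c := card X)) (SIGMA c:inner_corners X. standard_fillings (X - {c}))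
    (standard_fillings X)"
proof -
  define n where "n = card X"
  have fin: "finite X" by (rule shape_finite[OF X])
  have n: "n > 0" using fin \<open>X \<noteq> {}\<close> by (auto simp: n_def card_gt_0_iff)
  have smaller: "T d < n" if "c \<in> X" "T \<in> standard_fillings (X - {c})" "d \<in> X - {c}" for c d T
  proof -
    have "T d \<in> {1..card (X - {c})}"
      using that unfolding standard_fillings_def bij_betw_def by blast
    then show ?thesis
      using n fin that(1) by (auto simp: n_def)
  qed
  have ins: "insert n {1..n - 1} = {1..n}" using n by auto
  have inj: "inj_on (\<lambda>(c, T). T(c := n)) (SIGMA c:inner_corners X. standard_fillings (X - {c}))"
  proof (rule inj_onI, clarsimp)
    fix c1 c2 d1 d2 T T'
    assume c: "(c1, c2) \<in> inner_corners X" "T \<in> standard_fillings (X - {(c1, c2)})"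
      and d: "(d1, d2) \<in> inner_corners X" "T' \<in> standard_fillings (X - {(d1, d2)})"
      and eq: "T((c1, c2) := n) = T'((d1, d2) := n)"
    \<comment> \<open>The corner is recovered as the cell carrying the largest entry.\<close>
    have cd: "(c1, c2) = (d1, d2)"
    proof (rule ccontr)
      assume ne: "(c1, c2) \<noteq> (d1, d2)"
      then have "T' (c1, c2) = n"
        using eq by (metis fun_upd_same fun_upd_other)
      then show False
        using smaller[of "(d1, d2)" T' "(c1, c2)"] c d ne by (auto simp: inner_corners_def)
    qed
    moreover have "T = T'"
    proof
      fix x show "T x = T' x"
        using c(2) d(2) fun_cong[OF eq, of x] cd
        by (cases "x = (c1, c2)") (auto simp: standard_fillings_def extensional_def)
    qed
    ultimately show "c1 = d1 \<and> c2 = d2 \<and> T = T'" by simp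
  qed
  have sub: "T(c := n) \<in> standard_fillings X"
    if c: "c \<in> inner_corners X" and T: "T \<in> standard_fillings (X - {c})" for c T
  proof -
    have cX: "c \<in> X" and S: "shape (X - {c})"
      using c by (auto simp: inner_corners_def)
    have "bij_betw T (X - {c}) {1..n - 1}"
      using T cX fin by (simp add: standard_fillings_def n_def)
    then have "bij_betw (T(c := n)) (X - {c}) {1..n - 1}"
      by (rule bij_betw_cong[THEN iffD1, rotated]) simp
    then have "bij_betw (T(c := n)) (X - {c} \<union> {c}) ({1..n - 1} \<union> {(T(c := n)) c})"
      using n by (intro notIn_Un_bij_betw) auto
    then have bij: "bij_betw (T(c := n)) X {1..n}"
      using cX ins by (simp add: insert_absorb)
    have ext: "T(c := n) \<in> extensional X"
      using T cX by (auto simp: standard_fillings_def extensional_def)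
    have less: "(T(c := n)) (i, j) < (T(c := n)) (i', j')"
      if "(i', j') \<in> X" "i \<le> i'" "j \<le> j'" "(i, j) \<noteq> (i', j')" for i j i' j'
    proof (cases "(i', j') = c")
      case True
      then have "(i, j) \<in> X - {c}"
        using shapeD[OF X that(1-3)] that(4) by blast
      from smaller[OF cX T this] show ?thesis
        using True that(4) by auto
    next
      case False
      then have "(i, j) \<in> X - {c}"
        using shapeD[OF S, of i' j' i j] that by blast
      then show ?thesis
        using filling_less[OF S T, of i' j' i j] that False by auto
    qed
    show ?thesis
      unfolding standard_fillings_def using bij ext less by (auto simp: n_def)
  qed
  have sup: "\<exists>c T'. c \<in> inner_corners X \<and> T' \<in> standard_fillings (X - {c}) \<and> T'(c := n) = T"
    if T: "T \<in> standard_fillings X" for T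
  proof -
    have bij: "bij_betw T X {1..n}" and ext: "T \<in> extensional X"
      using T by (auto simp: standard_fillings_def n_def)
    then obtain c where cX: "c \<in> X" and Tc: "T c = n"
      using n unfolding bij_betw_def by (metis atLeastAtMost_iff imageE le_refl less_eq_Suc_le One_nat_def)
    have le: "T d \<le> n" if "d \<in> X" for d
      using bij that unfolding bij_betw_def by auto
    have S: "shape (X - {c})"
      unfolding shape_def
    proof (intro conjI allI impI)
      fix i j i' j' assume *: "(i, j) \<in> X - {c} \<and> i' \<le> i \<and> j' \<le> j"
      then have "(i', j') \<in> X"
        using shapeD[OF X] by blast
      moreover have "(i', j') \<noteq> c"
      proof
        assume "(i', j') = c"
        then have "T c < T (i, j)"
          using filling_less[OF X T, of i j i' j'] * by blast
        then show False
          using * le[of "(i, j)"] Tc by simp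
      qed
      ultimately show "(i', j') \<in> X - {c}" by simp
    qed (simp add: fin)
    define T' where "T' = T(c := undefined)"
    have "bij_betw T (X - {c}) ({1..n} - {T c})"
      using bij cX by (intro bij_betw_DiffI) (auto simp: bij_betw_def)
    also have "{1..n} - {T c} = {1..n - 1}" using Tc by auto
    finally have "bij_betw T' (X - {c}) {1..card (X - {c})}"
      using cX fin by (subst bij_betw_cong[of _ _ T]) (auto simp: T'_def n_def)
    moreover have "T' (i, j) < T' (i', j')"
      if "(i', j') \<in> X - {c}" "i \<le> i'" "j \<le> j'" "(i, j) \<noteq> (i', j')" for i j i' j'
      using filling_less[OF X T, of i' j' i j] that shapeD[OF S that(1-3)] by (auto simp: T'_def)
    moreover have "T' \<in> extensional (X - {c})"
      using ext by (auto simp: T'_def extensional_def)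
    ultimately have "T' \<in> standard_fillings (X - {c})"
      unfolding standard_fillings_def by auto
    moreover have "T'(c := n) = T" using Tc by (auto simp: T'_def)
    moreover have "c \<in> inner_corners X" using cX S by (simp add: inner_corners_def)
    ultimately show ?thesis by blast
  qed
  show ?thesis
    unfolding bij_betw_def n_def[symmetric]
  proof (intro conjI inj subset_antisym)
    show "(\<lambda>(c, T). T(c := n)) ` (SIGMA c:inner_corners X. standard_fillings (X - {c})) \<subseteq> standard_fillings X"
      using sub by auto
    show "standard_fillings X \<subseteq> (\<lambda>(c, T). T(c := n)) ` (SIGMA c:inner_corners X. standard_fillings (X - {c}))"
      using sup by (force simp: image_iff)
  qed
qed

lemma num_fillings_rec:
  assumes "shape X" and "X \<noteq> {}"
  shows "num_fillings X = (\<Sum>c\<in>inner_corners X. num_fillings (X - {c}))"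
  unfolding num_fillings_def
  using bij_betw_same_card[OF bij_betw_standard_fillings[OF assms]] shape_finite[OF assms(1)]
  by (simp add: card_SigmaI finite_standard_fillings finite_inner_corners[OF assms(1)])

text \<open>The commutation relation \<open>D U - U D = I\<close> of the operators \<open>U\<close> (add a cell) and \<open>D\<close> (remove a cell) on
  Young's lattice. If the added cell \<open>c\<close> and the removed cell \<open>d\<close> differ, the two operations can be
  performed in either order, because shapes are closed under union and intersection. If they agree,
  the result is \<open>X\<close> itself, once for each outer corner on the left and once for each inner corner on
  the right; these numbers differ by one.\<close>

lemma sum_up_down_commutation:
  fixes g :: "(nat \<times> nat) set \<Rightarrow> nat"
  assumes X: "shape X"
  shows "(\<Sum>c\<in>outer_corners X. \<Sum>d\<in>inner_corners (insert c X). g (insert c X - {d})) =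
    g X + (\<Sum>d\<in>inner_corners X. \<Sum>c\<in>outer_corners (X - {d}). g (insert c (X - {d})))"
proof -
  let ?E = "SIGMA c:outer_corners X. {d \<in> inner_corners (insert c X). d \<noteq> c}"
  let ?F = "SIGMA d:inner_corners X. {c \<in> outer_corners (X - {d}). c \<noteq> d}"
  have fin: "finite (inner_corners (insert c X))" if "c \<in> outer_corners X" for c
    using that by (simp add: outer_corners_def finite_inner_corners)
  have fin': "finite (outer_corners (X - {d}))" if "d \<in> inner_corners X" for d
    using that by (simp add: inner_corners_def finite_outer_corners)
  have "(\<Sum>d\<in>inner_corners (insert c X). g (insert c X - {d})) =
      g X + (\<Sum>d\<in>{d \<in> inner_corners (insert c X). d \<noteq> c}. g (insert c X - {d}))"
    if c: "c \<in> outer_corners X" for c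
  proof -
    have "c \<in> inner_corners (insert c X)" "insert c X - {c} = X"
      using c X by (auto simp: outer_corners_def inner_corners_def)
    moreover have "inner_corners (insert c X) - {c} = {d \<in> inner_corners (insert c X). d \<noteq> c}"
      by auto
    ultimately show ?thesis
      using sum.remove[OF fin[OF c], of c "\<lambda>d. g (insert c X - {d})"] by simp
  qed
  then have "(\<Sum>c\<in>outer_corners X. \<Sum>d\<in>inner_corners (insert c X). g (insert c X - {d})) =
      card (outer_corners X) * g X + (\<Sum>(c, d)\<in>?E. g (insert c X - {d}))"
    using finite_outer_corners[OF X] fin by (simp add: sum.distrib sum.Sigma)
  moreover have "(\<Sum>c\<in>outer_corners (X - {d}). g (insert c (X - {d}))) =
      g X + (\<Sum>c\<in>{c \<in> outer_corners (X - {d}). c \<noteq> d}. g (insert c (X - {d})))"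
    if d: "d \<in> inner_corners X" for d
  proof -
    have "d \<in> outer_corners (X - {d})" "insert d (X - {d}) = X"
      using d X by (auto simp: outer_corners_def inner_corners_def insert_absorb)
    moreover have "outer_corners (X - {d}) - {d} = {c \<in> outer_corners (X - {d}). c \<noteq> d}"
      by auto
    ultimately show ?thesis
      using sum.remove[OF fin'[OF d], of d "\<lambda>c. g (insert c (X - {d}))"] by simp
  qed
  then have "(\<Sum>d\<in>inner_corners X. \<Sum>c\<in>outer_corners (X - {d}). g (insert c (X - {d}))) =
      card (inner_corners X) * g X + (\<Sum>(d, c)\<in>?F. g (insert c (X - {d})))"
    using finite_inner_corners[OF X] fin' by (simp add: sum.distrib sum.Sigma)
  moreover have "(\<Sum>(c, d)\<in>?E. g (insert c X - {d})) = (\<Sum>(d, c)\<in>?F. g (insert c (X - {d})))"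
  proof (rule sum.reindex_bij_witness[of _ prod.swap prod.swap])
    fix p assume "p \<in> ?E"
    then obtain c d where p: "p = (c, d)" and *: "c \<notin> X" "d \<in> X" "shape (insert c X)" "shape (insert c X - {d})" "c \<noteq> d"
      by (auto simp: outer_corners_def inner_corners_def)
    have "shape (X - {d})"
      using shape_Int[OF X *(4)] *(1) by (metis Diff_insert_absorb Int_Diff Int_insert_right_if0 inf.idem)
    moreover have "insert c X - {d} = insert c (X - {d})" using * by auto
    ultimately show "prod.swap p \<in> ?F"
      using p * by (auto simp: outer_corners_def inner_corners_def)
    show "(case prod.swap p of (d, c) \<Rightarrow> g (insert c (X - {d}))) = (case p of (c, d) \<Rightarrow> g (insert c X - {d}))"
      using p \<open>insert c X - {d} = insert c (X - {d})\<close> by simp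
  next
    fix p assume "p \<in> ?F"
    then obtain c d where p: "p = (d, c)" and *: "c \<notin> X" "d \<in> X" "shape (X - {d})" "shape (insert c (X - {d}))" "c \<noteq> d"
      by (auto simp: outer_corners_def inner_corners_def)
    have "X \<union> insert c (X - {d}) = insert c X" using * by auto
    then have "shape (insert c X)"
      using shape_Un[OF X *(4)] by simp
    moreover have "insert c X - {d} = insert c (X - {d})" using * by auto
    ultimately show "prod.swap p \<in> ?E"
      using p * by (auto simp: outer_corners_def inner_corners_def)
  qed auto
  ultimately show ?thesis
    by (simp add: card_outer_corners[OF X])
qed

text \<open>Induction on the size: expand every summand by its inner corners, commute the two operations,
  and apply the induction hypothesis to the shapes \<open>X - {d}\<close>.\<close>

lemma sum_num_fillings_outer:
  assumes "shape X"
  shows "(\<Sum>c\<in>outer_corners X. num_fillings (insert c X)) = (card X + 1) * num_fillings X"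
  using assms
proof (induction "card X" arbitrary: X rule: less_induct)
  case less
  note X = less.prems
  have "(\<Sum>c\<in>outer_corners X. num_fillings (insert c X)) =
      (\<Sum>c\<in>outer_corners X. \<Sum>d\<in>inner_corners (insert c X). num_fillings (insert c X - {d}))"
    by (intro sum.cong refl num_fillings_rec) (auto simp: outer_corners_def)
  also have "\<dots> = num_fillings X +
      (\<Sum>d\<in>inner_corners X. \<Sum>c\<in>outer_corners (X - {d}). num_fillings (insert c (X - {d})))"
    by (rule sum_up_down_commutation[OF X])
  also have "(\<Sum>d\<in>inner_corners X. \<Sum>c\<in>outer_corners (X - {d}). num_fillings (insert c (X - {d}))) =
      (\<Sum>d\<in>inner_corners X. card X * num_fillings (X - {d}))"
  proof (rule sum.cong)
    fix d assume "d \<in> inner_corners X"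
    then have d: "d \<in> X" "shape (X - {d})" by (auto simp: inner_corners_def)
    moreover have "card X = Suc (card (X - {d}))"
      using d(1) shape_finite[OF X] by (metis card.remove)
    ultimately show "(\<Sum>c\<in>outer_corners (X - {d}). num_fillings (insert c (X - {d}))) =
        card X * num_fillings (X - {d})"
      using less.hyps[of "X - {d}"] by simp
  qed simp
  also have "\<dots> = card X * num_fillings X"
    using num_fillings_rec[OF X] by (cases "X = {}") (simp_all add: sum_distrib_left)
  finally show ?case by simp
qed

section \<open>Counting set partitions and orderings\<close>

text \<open>A partition of \<open>insert x A\<close> arises from a partition \<open>P\<close> of \<open>A\<close> in one of \<open>card P + 1\<close> ways: \<open>x\<close> joins one
  of the blocks, which keeps the number of blocks, or forms a block of its own.\<close>

lemma sum_partitions_insert: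
  fixes F :: "nat \<Rightarrow> nat"
  assumes A: "finite A" and x: "x \<notin> A"
  shows "(\<Sum>Q | partition_on (insert x A) Q. F (card Q)) =
    (\<Sum>P | partition_on A P. card P * F (card P) + F (Suc (card P)))"
proof -
  let ?P = "{P. partition_on A P}" and ?Q = "{Q. partition_on (insert x A) Q}"
  have finP: "finite P" if "partition_on A P" for P
    using finite_elements[OF A that] .
  have fin: "finite ?P" "finite ?Q"
    using A by (simp_all add: finitely_many_partition_on)
  have notin: "x \<notin> B" if "partition_on A P" "B \<in> P" for P B
    using that x by (auto simp: partition_on_def)
  have xP: "{x} \<notin> P" if "partition_on A P" for P
    using notin[OF that] by blast
  \<comment> \<open>The partitions in which the new element is a singleton block.\<close>
  have "(\<Sum>Q | partition_on (insert x A) Q \<and> {x} \<in> Q. F (card Q)) =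
      (\<Sum>P | partition_on A P. F (Suc (card P)))"
  proof (rule sum.reindex_bij_witness[of _ "insert {x}" "\<lambda>Q. Q - {{x}}"])
    fix Q assume "Q \<in> {Q. partition_on (insert x A) Q \<and> {x} \<in> Q}"
    then have Q: "partition_on (insert x A) (insert {x} (Q - {{x}}))" "{x} \<in> Q"
      by (auto simp: insert_absorb)
    have "disjnt {x} (\<Union>(Q - {{x}}))"
      using Q(1) unfolding partition_on_def pairwise_insert by (auto simp: disjnt_def)
    then show "Q - {{x}} \<in> {P. partition_on A P}"
      using Q x partition_on_insert[of "{x}" "Q - {{x}}"] by simp
    then show "F (Suc (card (Q - {{x}}))) = F (card Q)"
      using Q(2) finP by (metis card.remove card_Suc_Diff1 finite_Diff_insert finite_Diff2 finite.emptyI finite_insert mem_Collect_eq)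
  next
    fix P assume P: "P \<in> {P. partition_on A P}"
    have "disjnt {x} (\<Union>P)"
      using notin P by auto
    then show "insert {x} P \<in> {Q. partition_on (insert x A) Q \<and> {x} \<in> Q}"
      using P x partition_on_insert[of "{x}" P] by simp
    show "insert {x} P - {{x}} = P" using xP P by simp
  qed auto
  \<comment> \<open>The partitions in which it has company; the pair records the block it was added to.\<close>
  moreover have "(\<Sum>Q | partition_on (insert x A) Q \<and> {x} \<notin> Q. F (card Q)) =
      (\<Sum>(P, B)\<in>(SIGMA P:?P. P). F (card P))"
  proof (rule sum.reindex_bij_witness[of _ "\<lambda>(P, B). insert (insert x B) (P - {B})"
        "\<lambda>Q. ((\<lambda>B. B - {x}) ` Q, (THE B. x \<in> B \<and> B \<in> Q) - {x})"])
    fix p assume "p \<in> (SIGMA P:?P. P)"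
    then obtain P B where p: "p = (P, B)" "partition_on A P" "B \<in> P"
      by auto
    let ?R = "insert (insert x B) (P - {B})"
    have rest: "partition_on (A - B) (P - {B})" "B \<subseteq> A" "B \<noteq> {}"
    proof -
      have "disjnt B (\<Union>(P - {B}))"
        using p(2,3) unfolding partition_on_def pairwise_def disjnt_def by blast
      then show "partition_on (A - B) (P - {B})" "B \<subseteq> A" "B \<noteq> {}"
        using partition_on_insert[of B "P - {B}" A] p(2,3) by (auto simp: insert_absorb)
    qed
    have "disjnt (insert x B) (\<Union>(P - {B}))"
      using rest(1) x by (auto simp: partition_on_def disjnt_def)
    moreover have "insert x A - insert x B = A - B"
      using x by auto
    ultimately have "partition_on (insert x A) ?R"
      using rest partition_on_insert[of "insert x B" "P - {B}" "insert x A"] by auto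
    moreover have "{x} \<notin> ?R"
      using rest xP[OF p(2)] notin[OF p(2,3)] by auto
    ultimately show "(\<lambda>(P, B). insert (insert x B) (P - {B})) p \<in> {Q. partition_on (insert x A) Q \<and> {x} \<notin> Q}"
      by (simp add: p(1))
    have "(THE C. x \<in> C \<and> C \<in> ?R) = insert x B"
      using notin[OF p(2)] by (intro the_equality) auto
    moreover have "(\<lambda>B. B - {x}) ` (P - {B}) = P - {B}"
      using notin[OF p(2)] by (force simp: image_iff)
    then have "(\<lambda>B. B - {x}) ` ?R = P"
      using notin[OF p(2,3)] p(3) by auto
    ultimately show "((\<lambda>B. B - {x}) ` (\<lambda>(P, B). insert (insert x B) (P - {B})) p,
        (THE B. x \<in> B \<and> B \<in> (\<lambda>(P, B). insert (insert x B) (P - {B})) p) - {x}) = p"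
      using notin[OF p(2,3)] by (simp add: p(1))
  next
    fix Q assume "Q \<in> {Q. partition_on (insert x A) Q \<and> {x} \<notin> Q}"
    then have Q: "partition_on (insert x A) Q" "{x} \<notin> Q"
      by auto
    have "x \<in> \<Union>Q"
      unfolding partition_onD1[OF Q(1), symmetric] by (rule insertI1)
    then obtain C where C: "x \<in> C" "C \<in> Q"
      by (elim UnionE)
    have uniq: "D = C" if "x \<in> D" "D \<in> Q" for D
      using that C disjointD[OF partition_onD2[OF Q(1)], of D C] by auto
    have the: "(THE B. x \<in> B \<and> B \<in> Q) = C"
    proof (rule the_equality)
      show "x \<in> C \<and> C \<in> Q"
        using C by simp
      show "D = C" if "x \<in> D \<and> D \<in> Q" for D
        by (rule uniq) (simp_all add: that)
    qed
    have "disjnt C (\<Union>(Q - {C}))"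
      using disjointD[OF partition_onD2[OF Q(1)] C(2)] by (fastforce simp: disjnt_def)
    then have rest: "partition_on (insert x A - C) (Q - {C})" "C \<subseteq> insert x A"
      using partition_on_insert[of C "Q - {C}" "insert x A"] Q(1) C by (auto simp: insert_absorb)
    have "(\<lambda>B. B - {x}) ` (Q - {C}) = Q - {C}"
    proof -
      have "D - {x} = D" if "D \<in> Q - {C}" for D
        using uniq[of D] that by blast
      then show ?thesis by simp
    qed
    then have img: "(\<lambda>B. B - {x}) ` Q = insert (C - {x}) (Q - {C})"
      using C(2) by (metis image_insert insert_Diff)
    have ne: "C - {x} \<noteq> {}"
    proof
      assume "C - {x} = {}"
      then have "C = {x}" using C(1) by blast
      then show False using C(2) Q(2) by simp
    qed
    have "C - {x} \<notin> Q"
    proof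
      assume "C - {x} \<in> Q"
      then have "C - {x} \<in> Q - {C}" using C(1) by auto
      then show False using rest(1) ne by (auto simp: partition_on_def)
    qed
    have "disjnt (C - {x}) (\<Union>(Q - {C}))"
      using rest(1) by (auto simp: partition_on_def disjnt_def)
    moreover have "A - (C - {x}) = insert x A - C"
      using x C by auto
    ultimately have part: "partition_on A (insert (C - {x}) (Q - {C}))"
      using rest partition_on_insert[of "C - {x}" "Q - {C}" A] ne by auto
    then show "((\<lambda>B. B - {x}) ` Q, (THE B. x \<in> B \<and> B \<in> Q) - {x}) \<in> (SIGMA P:?P. P)"
      unfolding the img by simp
    show "(\<lambda>(P, B). insert (insert x B) (P - {B})) ((\<lambda>B. B - {x}) ` Q, (THE B. x \<in> B \<and> B \<in> Q) - {x}) = Q"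
      unfolding the img using C \<open>C - {x} \<notin> Q\<close> by (auto simp: insert_absorb)
    have "finite (Q - {C})"
      using finP[OF part] by simp
    then have "card (insert (C - {x}) (Q - {C})) = card Q"
      using C \<open>C - {x} \<notin> Q\<close> by (metis DiffD1 card.insert card_Suc_Diff1 finite_Diff_insert finite_Diff2 finite.emptyI finite_insert)
    then show "(case ((\<lambda>B. B - {x}) ` Q, (THE B. x \<in> B \<and> B \<in> Q) - {x}) of (P, B) \<Rightarrow> F (card P)) = F (card Q)"
      unfolding the img by simp
  qed
  moreover have "(\<Sum>(P, B)\<in>(SIGMA P:?P. P). F (card P)) = (\<Sum>P\<in>?P. card P * F (card P))"
    using fin(1) finP by (subst sum.Sigma[symmetric]) auto
  moreover have "(\<Sum>Q\<in>?Q. F (card Q)) =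
      (\<Sum>Q | partition_on (insert x A) Q \<and> {x} \<in> Q. F (card Q)) +
      (\<Sum>Q | partition_on (insert x A) Q \<and> {x} \<notin> Q. F (card Q))"
    using sum.Int_Diff[OF fin(2), of "\<lambda>Q. F (card Q)" "{Q. {x} \<in> Q}"]
    by (simp add: Int_def set_diff_eq)
  ultimately show ?thesis
    by (simp add: sum.distrib)
qed

lemma linear_order_on_has_greatest:
  assumes r: "linear_order_on A r" and "finite A" "A \<noteq> {}"
  shows "\<exists>m\<in>A. \<forall>a\<in>A. (a, m) \<in> r"
proof -
  have "B \<subseteq> A \<Longrightarrow> \<exists>m\<in>B. \<forall>a\<in>B. (a, m) \<in> r" if "finite B" "B \<noteq> {}" for B
    using that
  proof (induction rule: finite_ne_induct)
    case (singleton x)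
    then show ?case
      using r by (auto simp: order_on_defs refl_on_def)
  next
    case (insert x B)
    then obtain m where m: "m \<in> B" "\<forall>a\<in>B. (a, m) \<in> r"
      by auto
    have x: "x \<in> A" "m \<in> A" "(x, x) \<in> r"
      using insert.prems m(1) r by (auto simp: order_on_defs refl_on_def)
    then consider "(x, m) \<in> r" | "(m, x) \<in> r"
      using r by (metis order_on_defs(3) total_on_def)
    then show ?case
    proof cases
      case 1
      then show ?thesis using m by blast
    next
      case 2
      then have "(a, x) \<in> r" if "a \<in> B" for a
        using that m r unfolding order_on_defs by (meson transD)
      then show ?thesis using x by blast
    qed
  qed
  then show ?thesis
    using assms by blast
qed

text \<open>A linear order on a finite nonempty set is given by its greatest element and its restriction
  to the other elements. This is the factorial recursion.\<close>

lemma bij_betw_linear_orders: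
  assumes "finite A" "A \<noteq> {}"
  shows "bij_betw (\<lambda>(m, r). r \<union> A \<times> {m}) (SIGMA m:A. {r. linear_order_on (A - {m}) r})
    {r. linear_order_on A r}"
  unfolding bij_betw_def
proof (intro conjI subset_antisym)
  have sub: "r \<subseteq> B \<times> B" if "linear_order_on B r" for B :: "'a set" and r
    using that unfolding order_on_defs by blast
  show "inj_on (\<lambda>(m, r). r \<union> A \<times> {m}) (SIGMA m:A. {r. linear_order_on (A - {m}) r})"
  proof (rule inj_onI, clarsimp)
    fix m r n s
    assume m: "m \<in> A" "linear_order_on (A - {m}) r" and n: "n \<in> A" "linear_order_on (A - {n}) s"
      and eq: "r \<union> A \<times> {m} = s \<union> A \<times> {n}"
    have "(n, m) \<in> s \<union> A \<times> {n}"
      using eq n(1) by blast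
    then have "m = n"
      using sub[OF n(2)] by blast
    moreover have "r = (r \<union> A \<times> {m}) - A \<times> {m}" "s = (s \<union> A \<times> {n}) - A \<times> {n}"
      using sub[OF m(2)] sub[OF n(2)] by blast+
    ultimately show "m = n \<and> r = s"
      using eq by metis
  qed
  show "(\<lambda>(m, r). r \<union> A \<times> {m}) ` (SIGMA m:A. {r. linear_order_on (A - {m}) r}) \<subseteq> {r. linear_order_on A r}"
  proof clarify
    fix m r assume m: "m \<in> A" and r: "linear_order_on (A - {m}) r"
    have "r \<union> A \<times> {m} \<subseteq> A \<times> A" "refl_on A (r \<union> A \<times> {m})" "total_on A (r \<union> A \<times> {m})"
      using m sub[OF r] r unfolding order_on_defs refl_on_def total_on_def by blast+
    moreover have "trans (r \<union> A \<times> {m})"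
      using sub[OF r] r unfolding order_on_defs trans_def by blast
    moreover have "antisym (r \<union> A \<times> {m})"
      using sub[OF r] r unfolding order_on_defs antisym_def by blast
    ultimately show "linear_order_on A (r \<union> A \<times> {m})"
      unfolding order_on_defs by blast
  qed
  show "{r. linear_order_on A r} \<subseteq> (\<lambda>(m, r). r \<union> A \<times> {m}) ` (SIGMA m:A. {r. linear_order_on (A - {m}) r})"
  proof clarify
    fix r assume r: "linear_order_on A r"
    obtain m where m: "m \<in> A" "\<forall>a\<in>A. (a, m) \<in> r"
      using linear_order_on_has_greatest[OF r assms] by blast
    define s where "s = r \<inter> (A - {m}) \<times> (A - {m})"
    have "b = m" if "(m, b) \<in> r" for b
      using that m sub[OF r] r unfolding order_on_defs antisym_def by blast
    then have "r = s \<union> A \<times> {m}"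
      using m sub[OF r] by (auto simp: s_def)
    moreover have "s \<subseteq> (A - {m}) \<times> (A - {m})" "refl_on (A - {m}) s" "total_on (A - {m}) s"
      using r unfolding order_on_defs refl_on_def total_on_def s_def by blast+
    moreover have "trans s" "antisym s"
      using r unfolding order_on_defs trans_def antisym_def s_def by blast+
    ultimately have "r = s \<union> A \<times> {m}" "linear_order_on (A - {m}) s"
      unfolding order_on_defs by blast+
    then show "r \<in> (\<lambda>(m, r). r \<union> A \<times> {m}) ` (SIGMA m:A. {r. linear_order_on (A - {m}) r})"
      using m(1) by (intro image_eqI[of _ _ "(m, s)"]) auto
  qed
qed

lemma card_linear_orders:
  assumes "finite A"
  shows "card {r. linear_order_on A r} = fact (card A)"
  using assms
proof (induction "card A" arbitrary: A)
  case 0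
  then have "A = {}" by simp
  moreover have "linear_order_on {} r \<longleftrightarrow> r = {}" for r :: "'a rel"
    by (auto simp: order_on_defs)
  ultimately show ?case by simp
next
  case (Suc n)
  have fin: "finite {r. linear_order_on B r}" if "finite B" for B :: "'a set"
    by (rule finite_subset[of _ "Pow (B \<times> B)"]) (use that in \<open>auto simp: order_on_defs\<close>)
  have "A \<noteq> {}" using Suc.hyps(2) by auto
  then have "card {r. linear_order_on A r} = card (SIGMA m:A. {r. linear_order_on (A - {m}) r})"
    using bij_betw_same_card[OF bij_betw_linear_orders[OF Suc.prems]] by simp
  also have "\<dots> = (\<Sum>m\<in>A. card {r. linear_order_on (A - {m}) r})"
    using Suc.prems fin by (intro card_SigmaI) auto
  also have "\<dots> = (\<Sum>m\<in>A. fact n)"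
  proof (rule sum.cong)
    fix m assume "m \<in> A"
    then have "card (A - {m}) = n"
      using Suc.hyps(2) by (simp add: Suc.prems)
    then show "card {r. linear_order_on (A - {m}) r} = fact n"
      using Suc.hyps(1)[of "A - {m}"] Suc.prems by simp
  qed simp
  also have "\<dots> = fact (card A)"
    using Suc.hyps(2)[symmetric] by simp
  finally show ?case .
qed

text \<open>Once an element \<open>a\<close> is fixed, each rotation class of orderings of \<open>A\<close> contains exactly one list
  that starts with \<open>a\<close>, and the rest of this list is an arbitrary ordering of \<open>A - {a}\<close>.\<close>

lemma card_cyclic_orderings:
  assumes "finite A" "A \<noteq> {}"
  shows "card (cyclic_orderings A) = fact (card A - 1)"
proof -
  obtain a where a: "a \<in> A" using assms(2) by blast
  let ?rot = "{(xs, ys). \<exists>n. ys = rotate n xs}"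
  define cyc where "cyc ys = ?rot `` {a # ys}" for ys
  have mem: "a # ys \<in> permutations_of_set A" if "ys \<in> permutations_of_set (A - {a})" for ys
    using that a by (auto simp: permutations_of_set_def)
  have inj: "inj_on cyc (permutations_of_set (A - {a}))"
  proof (rule inj_onI)
    fix ys zs assume ys: "ys \<in> permutations_of_set (A - {a})" and zs: "zs \<in> permutations_of_set (A - {a})"
      and eq: "cyc ys = cyc zs"
    have "a # zs \<in> cyc zs" unfolding cyc_def by (auto intro: exI[of _ 0])
    then obtain n where n: "a # zs = rotate n (a # ys)"
      using eq by (auto simp: cyc_def)
    \<comment> \<open>A rotation that brings the entry with index m to the front can fix the head only if m = 0, as the entries are distinct.\<close>
    define m where "m = n mod length (a # ys)"
    have m: "m < length (a # ys)" by (simp add: m_def)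
    have "(a # ys) ! m = hd (rotate n (a # ys))"
      by (simp add: hd_rotate_conv_nth m_def)
    then have "(a # ys) ! m = (a # ys) ! 0"
      unfolding n[symmetric] by simp
    moreover have "distinct (a # ys)"
      using permutations_of_setD(2)[OF mem[OF ys]] .
    ultimately have "m = 0"
      using m nth_eq_iff_index_eq[of "a # ys" m 0] by simp
    then show "ys = zs"
      using n rotate_id[of n "a # ys"] by (simp add: m_def)
  qed
  have "cyclic_orderings A = cyc ` permutations_of_set (A - {a})"
  proof (intro subset_antisym subsetI)
    fix c assume "c \<in> cyclic_orderings A"
    then obtain xs where xs: "xs \<in> permutations_of_set A" and c: "c = ?rot `` {xs}"
      by (auto simp: cyclic_orderings_def quotient_def)
    then have xs_set: "set xs = A" and dist: "distinct xs" by (auto simp: permutations_of_set_def)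
    then obtain us vs where xs_eq: "xs = us @ a # vs"
      using a by (metis split_list)
    have rot: "rotate (length us) xs = a # vs @ us"
      using xs_eq rotate_append[of us "a # vs"] by simp
    have rot_back: "rotate (length (a # vs)) (a # vs @ us) = xs"
      using xs_eq rotate_append[of "a # vs" us] by simp
    have "c = cyc (vs @ us)"
    proof -
      have "(\<exists>n. zs = rotate n xs) \<longleftrightarrow> (\<exists>n. zs = rotate n (a # vs @ us))" for zs

        using rot rot_back by (metis rotate_rotate)
      then show ?thesis
        by (simp add: c cyc_def)
    qed
    moreover have "vs @ us \<in> permutations_of_set (A - {a})"
      using xs_set dist xs_eq by (auto simp: permutations_of_set_def)
    ultimately show "c \<in> cyc ` permutations_of_set (A - {a})" by blast
  next
    fix c assume "c \<in> cyc ` permutations_of_set (A - {a})"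
    then show "c \<in> cyclic_orderings A"
      using mem quotientI[of _ "permutations_of_set A" ?rot]
      by (auto simp: cyclic_orderings_def cyc_def simp del: Image_singleton)
  qed
  then have "card (cyclic_orderings A) = card (permutations_of_set (A - {a}))"
    using card_image[OF inj] by simp
  then show ?thesis
    using assms a by simp
qed

section \<open>Neighbours of an integer partition\<close>

definition partitions_above :: "nat list \<Rightarrow> nat list set" where
  "partitions_above \<nu> = {\<mu>. int_partition \<mu> \<and> young_diagram \<nu> \<subseteq> young_diagram \<mu> \<and>
     card (young_diagram \<mu> - young_diagram \<nu>) = 1}"

definition partitions_below :: "nat list \<Rightarrow> nat list set" where
  "partitions_below \<nu> = {\<mu>. int_partition \<mu> \<and> young_diagram \<mu> \<subseteq> young_diagram \<nu> \<and>
     card (young_diagram \<nu> - young_diagram \<mu>) = 1}"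

lemma bij_betw_partitions_above:
  "bij_betw young_diagram (partitions_above \<nu>)
    ((\<lambda>c. insert c (young_diagram \<nu>)) ` outer_corners (young_diagram \<nu>))"
proof -
  let ?X = "young_diagram \<nu>"
  have "young_diagram ` partitions_above \<nu> = (\<lambda>c. insert c ?X) ` outer_corners ?X"
  proof (intro subset_antisym subsetI)
    fix Y assume "Y \<in> young_diagram ` partitions_above \<nu>"
    then obtain \<mu> where \<mu>: "int_partition \<mu>" "?X \<subseteq> Y" "card (Y - ?X) = 1" "Y = young_diagram \<mu>"
      by (auto simp: partitions_above_def)
    then obtain c where "Y - ?X = {c}"
      by (auto simp: card_1_singleton_iff)
    then have "Y = insert c ?X" "c \<notin> ?X"
      using \<mu>(2) by auto
    moreover have "shape Y"
      using young_diagram_shape \<mu> by simp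
    ultimately show "Y \<in> (\<lambda>c. insert c ?X) ` outer_corners ?X"
      by (auto simp: outer_corners_def)
  next
    fix Y assume "Y \<in> (\<lambda>c. insert c ?X) ` outer_corners ?X"
    then obtain c where c: "c \<notin> ?X" "Y = insert c ?X" "shape Y"
      by (auto simp: outer_corners_def)
    then obtain \<mu> where \<mu>: "int_partition \<mu>" "Y = young_diagram \<mu>"
      using bij_betw_imp_surj_on[OF bij_betw_young_diagram] by blast
    have "Y - ?X = {c}"
      using c by auto
    then have "\<mu> \<in> partitions_above \<nu>"
      using \<mu> c by (auto simp: partitions_above_def)
    then show "Y \<in> young_diagram ` partitions_above \<nu>"
      using \<mu>(2) by blast
  qed
  moreover have "inj_on young_diagram (partitions_above \<nu>)"
    by (rule inj_on_subset[OF bij_betw_imp_inj_on[OF bij_betw_young_diagram]])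
      (auto simp: partitions_above_def)
  ultimately show ?thesis
    by (simp add: bij_betw_def)
qed

lemma bij_betw_partitions_below:
  "bij_betw young_diagram (partitions_below \<nu>)
    ((\<lambda>c. young_diagram \<nu> - {c}) ` inner_corners (young_diagram \<nu>))"
proof -
  let ?X = "young_diagram \<nu>"
  have "young_diagram ` partitions_below \<nu> = (\<lambda>c. ?X - {c}) ` inner_corners ?X"
  proof (intro subset_antisym subsetI)
    fix Y assume "Y \<in> young_diagram ` partitions_below \<nu>"
    then obtain \<mu> where \<mu>: "int_partition \<mu>" "Y \<subseteq> ?X" "card (?X - Y) = 1" "Y = young_diagram \<mu>"
      by (auto simp: partitions_below_def)
    then obtain c where "?X - Y = {c}"
      by (auto simp: card_1_singleton_iff)
    then have "Y = ?X - {c}" "c \<in> ?X"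
      using \<mu>(2) by auto
    moreover have "shape Y"
      using young_diagram_shape \<mu> by simp
    ultimately show "Y \<in> (\<lambda>c. ?X - {c}) ` inner_corners ?X"
      by (auto simp: inner_corners_def)
  next
    fix Y assume "Y \<in> (\<lambda>c. ?X - {c}) ` inner_corners ?X"
    then obtain c where c: "c \<in> ?X" "Y = ?X - {c}" "shape Y"
      by (auto simp: inner_corners_def)
    then obtain \<mu> where \<mu>: "int_partition \<mu>" "Y = young_diagram \<mu>"
      using bij_betw_imp_surj_on[OF bij_betw_young_diagram] by blast
    have "?X - Y = {c}"
      using c by auto
    then have "\<mu> \<in> partitions_below \<nu>"
      using \<mu> c by (auto simp: partitions_below_def)
    then show "Y \<in> young_diagram ` partitions_below \<nu>"
      using \<mu>(2) by blast
  qed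
  moreover have "inj_on young_diagram (partitions_below \<nu>)"
    by (rule inj_on_subset[OF bij_betw_imp_inj_on[OF bij_betw_young_diagram]])
      (auto simp: partitions_below_def)
  ultimately show ?thesis
    by (simp add: bij_betw_def)
qed

lemma finite_partitions_above: "int_partition \<nu> \<Longrightarrow> finite (partitions_above \<nu>)"
  using bij_betw_finite[OF bij_betw_partitions_above] finite_outer_corners young_diagram_shape by blast

lemma finite_partitions_below: "int_partition \<nu> \<Longrightarrow> finite (partitions_below \<nu>)"
  using bij_betw_finite[OF bij_betw_partitions_below] finite_inner_corners young_diagram_shape by blast

lemma sum_num_SYT_above:
  assumes "int_partition \<nu>"
  shows "(\<Sum>\<mu>\<in>partitions_above \<nu>. num_SYT \<mu>) = (sum_list \<nu> + 1) * num_SYT \<nu>"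
proof -
  let ?X = "young_diagram \<nu>"
  have "(\<Sum>\<mu>\<in>partitions_above \<nu>. num_SYT \<mu>) = (\<Sum>Y\<in>(\<lambda>c. insert c ?X) ` outer_corners ?X. num_fillings Y)"
    using sum.reindex_bij_betw[OF bij_betw_partitions_above, of num_fillings]
    by (simp add: num_SYT_eq_num_fillings)
  also have "\<dots> = (\<Sum>c\<in>outer_corners ?X. num_fillings (insert c ?X))"
    by (rule sum.reindex_cong[of "\<lambda>c. insert c ?X"]) (auto simp: inj_on_def outer_corners_def)
  also have "\<dots> = (sum_list \<nu> + 1) * num_SYT \<nu>"
    using sum_num_fillings_outer[OF young_diagram_shape[OF assms]]
    by (simp add: card_young_diagram num_SYT_eq_num_fillings)
  finally show ?thesis .
qed

text \<open>\<open>num_fillings_rec\<close> for partitions. It has to exclude the empty partition, which has one tableau but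
  nothing below it.\<close>

lemma sum_num_SYT_below:
  assumes "int_partition \<nu>" "\<nu> \<noteq> []"
  shows "(\<Sum>\<mu>\<in>partitions_below \<nu>. num_SYT \<mu>) = num_SYT \<nu>"
proof -
  let ?X = "young_diagram \<nu>"
  have "?X \<noteq> {}"
    using assms inj_onD[OF bij_betw_imp_inj_on[OF bij_betw_young_diagram], of \<nu> "[]"]
    by (auto simp: int_partition_def young_diagram_def)
  have "(\<Sum>\<mu>\<in>partitions_below \<nu>. num_SYT \<mu>) = (\<Sum>Y\<in>(\<lambda>c. ?X - {c}) ` inner_corners ?X. num_fillings Y)"
    using sum.reindex_bij_betw[OF bij_betw_partitions_below, of num_fillings]
    by (simp add: num_SYT_eq_num_fillings)
  also have "\<dots> = (\<Sum>c\<in>inner_corners ?X. num_fillings (?X - {c}))"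
    by (rule sum.reindex_cong[of "\<lambda>c. ?X - {c}"]) (auto simp: inj_on_def inner_corners_def)
  also have "\<dots> = num_SYT \<nu>"
    using num_fillings_rec[OF young_diagram_shape[OF assms(1)] \<open>?X \<noteq> {}\<close>]
    by (simp add: num_SYT_eq_num_fillings)
  finally show ?thesis .
qed

lemma sum_list_above: "\<mu> \<in> partitions_above \<nu> \<Longrightarrow> sum_list \<mu> = Suc (sum_list \<nu>)"
  unfolding partitions_above_def
  by clarify (metis One_nat_def add.commute card_Diff_subset card_mono card_young_diagram finite_young_diagram
      le_add_diff_inverse2 plus_1_eq_Suc)

lemma sum_list_below: "\<mu> \<in> partitions_below \<nu> \<Longrightarrow> sum_list \<nu> = Suc (sum_list \<mu>)"
  unfolding partitions_below_def
  by clarify (metis One_nat_def add.commute card_Diff_subset card_mono card_young_diagram finite_young_diagram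
      le_add_diff_inverse2 plus_1_eq_Suc)

section \<open>Weighted sums over vacillating tableaux\<close>

text \<open>Collecting the tableaux of all shapes makes \<open>v_half\<close> a single sum over tableaux and lets the length
  be the only induction parameter.\<close>

definition vacillating_tableaux :: "nat \<Rightarrow> nat list list set" where
  "vacillating_tableaux k = (\<Union>\<mu>. limiting_vacillating_tableaux k \<mu>)"

text \<open>In each deletion step, the two permitted cardinalities 0 and 1 mean that the partition is kept
  or replaced by one below it.\<close>

lemma vacillating_tableaux_iff:
  "M \<in> vacillating_tableaux k \<longleftrightarrow>
    length M = 2 * k + 2 \<and> (\<forall>\<nu>\<in>set M. int_partition \<nu>) \<and> M ! 0 = [] \<and>
    (\<forall>j\<le>k. M ! (2 * j + 1) \<in> insert (M ! (2 * j)) (partitions_below (M ! (2 * j)))) \<and>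
    (\<forall>j<k. M ! (2 * j + 2) \<in> partitions_above (M ! (2 * j + 1)))"
proof -
  have below: "young_diagram \<nu> \<subseteq> young_diagram \<mu> \<and> card (young_diagram \<mu> - young_diagram \<nu>) \<in> {0, 1}
      \<longleftrightarrow> \<nu> \<in> insert \<mu> (partitions_below \<mu>)" if "int_partition \<nu>" "int_partition \<mu>" for \<mu> \<nu>
  proof -
    have "young_diagram \<nu> \<subseteq> young_diagram \<mu> \<and> card (young_diagram \<mu> - young_diagram \<nu>) = 0 \<longleftrightarrow>
        young_diagram \<nu> = young_diagram \<mu>"
      using finite_young_diagram by auto
    also have "\<dots> \<longleftrightarrow> \<nu> = \<mu>"
      using inj_on_eq_iff[OF bij_betw_imp_inj_on[OF bij_betw_young_diagram]] that by simp
    finally show ?thesis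
      using that by (auto simp: partitions_below_def)
  qed
  have above: "young_diagram \<nu> \<subseteq> young_diagram \<mu> \<and> card (young_diagram \<mu> - young_diagram \<nu>) = 1
      \<longleftrightarrow> \<mu> \<in> partitions_above \<nu>" if "int_partition \<mu>" for \<mu> \<nu>
    using that by (simp add: partitions_above_def)
  have part: "int_partition (M ! i)"
    if "length M = 2 * k + 2" "\<forall>\<nu>\<in>set M. int_partition \<nu>" "i < 2 * k + 2" for i
    using that by (metis nth_mem)
  have "M \<in> vacillating_tableaux k \<longleftrightarrow>
    length M = 2 * k + 2 \<and> (\<forall>\<nu>\<in>set M. int_partition \<nu>) \<and> M ! 0 = [] \<and>
    (\<forall>j\<le>k. young_diagram (M ! (2 * j + 1)) \<subseteq> young_diagram (M ! (2 * j)) \<and>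
        card (young_diagram (M ! (2 * j)) - young_diagram (M ! (2 * j + 1))) \<in> {0, 1}) \<and>
    (\<forall>j<k. young_diagram (M ! (2 * j + 1)) \<subseteq> young_diagram (M ! (2 * j + 2)) \<and>
        card (young_diagram (M ! (2 * j + 2)) - young_diagram (M ! (2 * j + 1))) = 1)"
    by (simp add: vacillating_tableaux_def limiting_vacillating_tableaux_def)
  then show ?thesis
    by (elim ssubst, intro conj_cong refl all_cong below above) (rule part; simp)+
qed

lemma limiting_vacillating_tableaux_eq:
  "limiting_vacillating_tableaux k \<mu> = {M \<in> vacillating_tableaux k. M ! (2 * k + 1) = \<mu>}"
  by (auto simp: vacillating_tableaux_def limiting_vacillating_tableaux_def)

lemma vacillating_tableaux_last_int_partition:
  assumes "M \<in> vacillating_tableaux k"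
  shows "int_partition (M ! (2 * k + 1))"
  using assms by (simp add: vacillating_tableaux_iff)

lemma finite_vacillating_tableaux: "finite (vacillating_tableaux k)"
proof -
  have "vacillating_tableaux k \<subseteq>
      (\<Union>\<mu>\<in>{\<mu>. int_partition \<mu> \<and> a_half k \<mu> \<noteq> 0}. limiting_vacillating_tableaux k \<mu>)"
  proof
    fix M assume M: "M \<in> vacillating_tableaux k"
    then have "M \<in> limiting_vacillating_tableaux k (M ! (2 * k + 1))"
      by (simp add: limiting_vacillating_tableaux_eq)
    moreover from this have "a_half k (M ! (2 * k + 1)) \<noteq> 0"
      using finite_limiting_vacillating_tableaux by (auto simp: a_half_def)
    ultimately show "M \<in> (\<Union>\<mu>\<in>{\<mu>. int_partition \<mu> \<and> a_half k \<mu> \<noteq> 0}. limiting_vacillating_tableaux k \<mu>)"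
      using vacillating_tableaux_last_int_partition[OF M] by blast
  qed
  then show ?thesis
    by (rule finite_subset)
      (intro finite_UN_I finite_support_a_half finite_limiting_vacillating_tableaux)
qed

lemma v_half_eq_sum_tableaux: "v_half k = (\<Sum>M\<in>vacillating_tableaux k. num_SYT (M ! (2 * k + 1)))"
proof -
  let ?S = "{\<mu>. int_partition \<mu> \<and> a_half k \<mu> \<noteq> 0}"
  have "(\<lambda>M. M ! (2 * k + 1)) ` vacillating_tableaux k \<subseteq> ?S"
  proof clarify
    fix M assume M: "M \<in> vacillating_tableaux k"
    then have "M \<in> limiting_vacillating_tableaux k (M ! (2 * k + 1))"
      by (simp add: limiting_vacillating_tableaux_eq)
    then show "int_partition (M ! (2 * k + 1)) \<and> a_half k (M ! (2 * k + 1)) \<noteq> 0"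
      using finite_limiting_vacillating_tableaux vacillating_tableaux_last_int_partition[OF M]
      by (auto simp: a_half_def)
  qed
  from sum.group[OF finite_vacillating_tableaux finite_support_a_half this, of "\<lambda>M. num_SYT (M ! (2 * k + 1))"]
  show ?thesis
    by (simp add: v_half_def a_half_def limiting_vacillating_tableaux_eq)
qed

lemma sum_tableaux_0:
  fixes \<phi> :: "nat list \<Rightarrow> nat"
  shows "(\<Sum>M\<in>vacillating_tableaux 0. \<phi> (M ! 1)) = \<phi> []"
proof -
  have "partitions_below [] = {}"
    by (auto simp: partitions_below_def young_diagram_def)
  then have "M \<in> vacillating_tableaux 0 \<longleftrightarrow> M = [[], []]" for M
    by (auto simp: vacillating_tableaux_iff int_partition_def length_Suc_conv numeral_2_eq_2)
  then have "vacillating_tableaux 0 = {[[], []]}"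
    by blast
  then show ?thesis
    by simp
qed

text \<open>Lengthening a tableau by one step appends a partition \<open>\<mu>\<close> above the last one and then either \<open>\<mu>\<close> again
  or a partition below \<open>\<mu>\<close>.\<close>

lemma sum_tableaux_Suc:
  fixes \<phi> :: "nat list \<Rightarrow> nat"
  shows "(\<Sum>M\<in>vacillating_tableaux (Suc k). \<phi> (M ! (2 * k + 3))) =
    (\<Sum>M\<in>vacillating_tableaux k. \<Sum>\<mu>\<in>partitions_above (M ! (2 * k + 1)).
       \<phi> \<mu> + (\<Sum>\<nu>\<in>partitions_below \<mu>. \<phi> \<nu>))"
proof -
  let ?V = "vacillating_tableaux k"
  let ?up = "\<lambda>M. partitions_above (M ! (2 * k + 1))"
  let ?down = "\<lambda>\<mu>. insert \<mu> (partitions_below \<mu>)"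
  have "(\<Sum>M\<in>vacillating_tableaux (Suc k). \<phi> (M ! (2 * k + 3))) =
      (\<Sum>(M, \<mu>, \<nu>)\<in>(SIGMA M:?V. SIGMA \<mu>:?up M. ?down \<mu>). \<phi> \<nu>)"
  proof (rule sum.reindex_bij_witness[of _ "\<lambda>(M, \<mu>, \<nu>). M @ [\<mu>, \<nu>]"
        "\<lambda>M. (take (2 * k + 2) M, M ! (2 * k + 2), M ! (2 * k + 3))"])
    fix M assume M: "M \<in> vacillating_tableaux (Suc k)"
    then have len: "length M = 2 * k + 4"
      by (simp add: vacillating_tableaux_iff)
    have "drop (2 * k + 2) M = [M ! (2 * k + 2), M ! (2 * k + 3)]"
      using len by (intro nth_equalityI[where 'a = "nat list"]) (auto simp: numeral_3_eq_3 dest!: less_2_cases)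
    then show "(case (take (2 * k + 2) M, M ! (2 * k + 2), M ! (2 * k + 3)) of (M, \<mu>, \<nu>) \<Rightarrow> M @ [\<mu>, \<nu>]) = M"
      by (metis append_take_drop_id case_prod_conv)
    show "(take (2 * k + 2) M, M ! (2 * k + 2), M ! (2 * k + 3)) \<in> (SIGMA M:?V. SIGMA \<mu>:?up M. ?down \<mu>)"
    proof -
      have below: "M ! (2 * j + 1) \<in> ?down (M ! (2 * j))" if "j \<le> Suc k" for j
        using M that unfolding vacillating_tableaux_iff by blast
      have above: "M ! (2 * j + 2) \<in> partitions_above (M ! (2 * j + 1))" if "j < Suc k" for j
        using M that unfolding vacillating_tableaux_iff by blast
      have "\<forall>\<nu>\<in>set M. int_partition \<nu>" "M ! 0 = []"
        using M unfolding vacillating_tableaux_iff by blast+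
      then have "take (2 * k + 2) M \<in> ?V"
        using len below above by (auto simp: vacillating_tableaux_iff dest: in_set_takeD)
      then show ?thesis
        using below[of "Suc k"] above[of k] by (simp add: numeral_3_eq_3)
    qed
  next
    fix p assume "p \<in> (SIGMA M:?V. SIGMA \<mu>:?up M. ?down \<mu>)"
    then obtain M \<mu> \<nu> where p: "p = (M, \<mu>, \<nu>)" and M: "M \<in> ?V" and up: "\<mu> \<in> ?up M" and down: "\<nu> \<in> ?down \<mu>"
      by auto
    have len: "length M = 2 * k + 2"
      using M by (simp add: vacillating_tableaux_iff)
    let ?N = "M @ [\<mu>, \<nu>]"
    have nth: "?N ! i = M ! i" if "i < 2 * k + 2" for i
      using that len by (simp add: nth_append)
    have nth': "?N ! (2 * k + 2) = \<mu>" "?N ! (2 * k + 3) = \<nu>"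
      using len by (simp_all add: nth_append)
    show "(take (2 * k + 2) (case p of (M, \<mu>, \<nu>) \<Rightarrow> M @ [\<mu>, \<nu>]), (case p of (M, \<mu>, \<nu>) \<Rightarrow> M @ [\<mu>, \<nu>]) ! (2 * k + 2),
        (case p of (M, \<mu>, \<nu>) \<Rightarrow> M @ [\<mu>, \<nu>]) ! (2 * k + 3)) = p"
      using len nth' by (simp add: p)
    have "\<forall>\<nu>\<in>set ?N. int_partition \<nu>"
      using M up down by (auto simp: vacillating_tableaux_iff partitions_above_def partitions_below_def)
    moreover have "?N ! 0 = []"
      using M nth[of 0] by (simp add: vacillating_tableaux_iff)
    moreover have "?N ! (2 * j + 1) \<in> ?down (?N ! (2 * j))" if "j \<le> Suc k" for j
    proof (cases "j = Suc k")
      case True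
      then have "2 * j + 1 = 2 * k + 3" "2 * j = 2 * k + 2" by auto
      then show ?thesis
        using down nth' by metis
    next
      case False
      then have "j \<le> k" using that by simp
      then have "M ! (2 * j + 1) \<in> ?down (M ! (2 * j))"
        using M unfolding vacillating_tableaux_iff by blast
      then show ?thesis
        using nth[of "2 * j + 1"] nth[of "2 * j"] \<open>j \<le> k\<close> by simp
    qed
    moreover have "?N ! (2 * j + 2) \<in> partitions_above (?N ! (2 * j + 1))" if "j < Suc k" for j
    proof (cases "j = k")
      case True
      then show ?thesis
        using up nth' nth[of "2 * k + 1"] by simp
    next
      case False
      then have "j < k" using that by simp
      then have "M ! (2 * j + 2) \<in> partitions_above (M ! (2 * j + 1))"
        using M unfolding vacillating_tableaux_iff by blast
      then show ?thesis
        using nth[of "2 * j + 2"] nth[of "2 * j + 1"] \<open>j < k\<close> by simp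
    qed
    ultimately have "?N \<in> vacillating_tableaux (Suc k)"
      using len unfolding vacillating_tableaux_iff by simp
    then show "(case p of (M, \<mu>, \<nu>) \<Rightarrow> M @ [\<mu>, \<nu>]) \<in> vacillating_tableaux (Suc k)"
      by (simp add: p)
  qed auto
  also have "\<dots> = (\<Sum>M\<in>?V. \<Sum>\<mu>\<in>?up M. \<Sum>\<nu>\<in>?down \<mu>. \<phi> \<nu>)"
  proof -
    have up: "finite (?up M)" if "M \<in> ?V" for M
      using finite_partitions_above[OF vacillating_tableaux_last_int_partition[OF that]] .
    have down: "finite (?down \<mu>)" if "\<mu> \<in> ?up M" for \<mu> M
      using that by (simp add: partitions_above_def finite_partitions_below)
    have "(\<Sum>M\<in>?V. \<Sum>\<mu>\<in>?up M. \<Sum>\<nu>\<in>?down \<mu>. \<phi> \<nu>) = (\<Sum>M\<in>?V. \<Sum>(\<mu>, \<nu>)\<in>(SIGMA \<mu>:?up M. ?down \<mu>). \<phi> \<nu>)"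
      by (rule sum.cong[OF refl], rule sum.Sigma, erule up, intro ballI, erule down)
    also have "\<dots> = (\<Sum>(M, \<mu>, \<nu>)\<in>(SIGMA M:?V. SIGMA \<mu>:?up M. ?down \<mu>). \<phi> \<nu>)"
      by (intro sum.Sigma ballI finite_SigmaI up down finite_vacillating_tableaux)
    finally show ?thesis by simp
  qed
  also have "\<dots> = (\<Sum>M\<in>?V. \<Sum>\<mu>\<in>?up M. \<phi> \<mu> + (\<Sum>\<nu>\<in>partitions_below \<mu>. \<phi> \<nu>))"
  proof (intro sum.cong refl)
    fix M \<mu> assume "\<mu> \<in> ?up M"
    then have "finite (partitions_below \<mu>)"
      by (simp add: partitions_above_def finite_partitions_below)
    moreover have "\<mu> \<notin> partitions_below \<mu>"
      by (simp add: partitions_below_def)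
    ultimately show "(\<Sum>\<nu>\<in>?down \<mu>. \<phi> \<nu>) = \<phi> \<mu> + (\<Sum>\<nu>\<in>partitions_below \<mu>. \<phi> \<nu>)"
      by simp
  qed
  finally show ?thesis .
qed

text \<open>The effect of one such step on a weight that is \<open>num_SYT\<close> times a function of the size. The addition
  multiplies the total of \<open>num_SYT\<close> by \<open>sum_list \<nu> + 1\<close> and raises the size by one, the deletion preserves
  the total and lowers the size again, so the outcome has the same form and individual shapes no longer matter. The
  partition \<open>\<mu>\<close> is never empty here, so the deletion identity applies.\<close>

lemma sum_tableaux_step:
  fixes g :: "nat \<Rightarrow> nat"
  assumes "int_partition \<nu>"
  shows "(\<Sum>\<mu>\<in>partitions_above \<nu>. num_SYT \<mu> * g (sum_list \<mu>) +
      (\<Sum>\<rho>\<in>partitions_below \<mu>. num_SYT \<rho> * g (sum_list \<rho>))) =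
    num_SYT \<nu> * ((sum_list \<nu> + 1) * (g (sum_list \<nu>) + g (sum_list \<nu> + 1)))"
proof -
  let ?n = "sum_list \<nu>"
  have "num_SYT \<mu> * g (sum_list \<mu>) + (\<Sum>\<rho>\<in>partitions_below \<mu>. num_SYT \<rho> * g (sum_list \<rho>)) =
      num_SYT \<mu> * (g ?n + g (?n + 1))" if \<mu>: "\<mu> \<in> partitions_above \<nu>" for \<mu>
  proof -
    have "(\<Sum>\<rho>\<in>partitions_below \<mu>. num_SYT \<rho> * g (sum_list \<rho>)) = (\<Sum>\<rho>\<in>partitions_below \<mu>. num_SYT \<rho> * g ?n)"
      using sum_list_above[OF \<mu>] sum_list_below by (intro sum.cong refl) fastforce
    also have "\<dots> = (\<Sum>\<rho>\<in>partitions_below \<mu>. num_SYT \<rho>) * g ?n"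
      by (simp add: sum_distrib_right)
    also have "(\<Sum>\<rho>\<in>partitions_below \<mu>. num_SYT \<rho>) = num_SYT \<mu>"
      using \<mu> sum_list_above[OF \<mu>] by (intro sum_num_SYT_below) (auto simp: partitions_above_def)
    finally show ?thesis
      using sum_list_above[OF \<mu>] by (simp add: algebra_simps)
  qed
  then have "(\<Sum>\<mu>\<in>partitions_above \<nu>. num_SYT \<mu> * g (sum_list \<mu>) +
      (\<Sum>\<rho>\<in>partitions_below \<mu>. num_SYT \<rho> * g (sum_list \<rho>))) =
      (\<Sum>\<mu>\<in>partitions_above \<nu>. num_SYT \<mu>) * (g ?n + g (?n + 1))"
    by (simp add: sum_distrib_right)
  then show ?thesis
    using sum_num_SYT_above[OF assms] by (simp add: algebra_simps)
qed

text \<open>Both sides are functionals of \<open>g\<close> that satisfy the same recursion in \<open>k\<close>: the value for \<open>k + 1\<close> at \<open>g\<close>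
  is the value for \<open>k\<close> at \<open>h m = (m + 1) * (g m + g (m + 1))\<close>. On the right, a partition with \<open>m + 1\<close>
  blocks contributes \<open>(m + 1) * m! * g m\<close> by enlarging a block and \<open>(m + 1)! * g (m + 1)\<close> by a new
  block, and the sum of the two is \<open>m! * h m\<close>. The weight \<open>g\<close> has to be arbitrary because the recursion changes it.\<close>

lemma weighted_sum_tableaux_eq_partitions:
  fixes g :: "nat \<Rightarrow> nat"
  shows "(\<Sum>M\<in>vacillating_tableaux k. num_SYT (M ! (2 * k + 1)) * g (sum_list (M ! (2 * k + 1)))) =
    (\<Sum>P | partition_on {1..k + 1} P. fact (card P - 1) * g (card P - 1))"
proof (induction k arbitrary: g)
  case 0
  have "num_SYT [] = 1"
    using num_fillings_empty by (simp add: num_SYT_eq_num_fillings young_diagram_def)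
  moreover have "partition_on {1..0 + 1} P \<longleftrightarrow> P = {{1::nat}}" for P
  proof
    assume P: "partition_on {1..0 + 1} P"
    then have "P \<subseteq> Pow {1} - {{}}" "\<Union>P = {1}"
      by (auto simp: partition_on_def)
    moreover have "Pow {1} - {{}} = {{1::nat}}" by auto
    ultimately show "P = {{1}}" by (metis Sup_empty empty_not_insert subset_singletonD)
  qed (simp add: partition_on_space)
  ultimately show ?case
    using sum_tableaux_0[of "\<lambda>\<mu>. num_SYT \<mu> * g (sum_list \<mu>)"] by simp
next
  case (Suc k)
  let ?h = "\<lambda>m. (m + 1) * (g m + g (m + 1))"
  have last: "2 * Suc k + 1 = 2 * k + 3"
    by simp
  have "(\<Sum>M\<in>vacillating_tableaux (Suc k). num_SYT (M ! (2 * Suc k + 1)) * g (sum_list (M ! (2 * Suc k + 1)))) =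
      (\<Sum>M\<in>vacillating_tableaux k. \<Sum>\<mu>\<in>partitions_above (M ! (2 * k + 1)).
        num_SYT \<mu> * g (sum_list \<mu>) + (\<Sum>\<nu>\<in>partitions_below \<mu>. num_SYT \<nu> * g (sum_list \<nu>)))"
    unfolding last by (rule sum_tableaux_Suc)
  also have "\<dots> = (\<Sum>M\<in>vacillating_tableaux k. num_SYT (M ! (2 * k + 1)) * ?h (sum_list (M ! (2 * k + 1))))"
    by (intro sum.cong refl sum_tableaux_step vacillating_tableaux_last_int_partition)
  also have "\<dots> = (\<Sum>P | partition_on {1..k + 1} P. fact (card P - 1) * ?h (card P - 1))"
    by (rule Suc.IH)
  also have "\<dots> = (\<Sum>P | partition_on {1..k + 1} P.
      card P * (fact (card P - 1) * g (card P - 1)) + fact (Suc (card P) - 1) * g (Suc (card P) - 1))"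
  proof (rule sum.cong)
    fix P assume "P \<in> {P. partition_on {1..k + 1} P}"
    then have "card P \<noteq> 0"
      using finite_elements[of "{1..k + 1}" P] by (auto simp: partition_on_def)
    then obtain m where "card P = Suc m"
      using not0_implies_Suc by blast
    then show "fact (card P - 1) * ?h (card P - 1) =
        card P * (fact (card P - 1) * g (card P - 1)) + fact (Suc (card P) - 1) * g (Suc (card P) - 1)"
      by (simp add: algebra_simps)
  qed simp
  also have "\<dots> = (\<Sum>P | partition_on (insert (Suc k + 1) {1..k + 1}) P. fact (card P - 1) * g (card P - 1))"
    by (rule sum_partitions_insert[symmetric]) auto
  also have "insert (Suc k + 1) {1..k + 1} = {1..Suc k + 1}"
    by auto
  finally show ?case .
qed

lemma v_half_eq_sum_partitions:
  "v_half k = (\<Sum>P | partition_on {1..k + 1} P. fact (card P - 1))"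
  using weighted_sum_tableaux_eq_partitions[of k "\<lambda>_. 1"] by (simp add: v_half_eq_sum_tableaux)

section \<open>Set partitions with ordered blocks\<close>

lemma card_cyclically_ordered_set_partitions:
  assumes "finite S" "S \<noteq> {}"
  shows "card (cyclically_ordered_set_partitions S) = (\<Sum>P | partition_on S P. fact (card P - 1))"
proof -
  have P: "finite P" "P \<noteq> {}" if "partition_on S P" for P
    using that assms finite_elements by (auto simp: partition_on_def)
  have "finite (cyclic_orderings P)" if "finite P" for P :: "'a set set"
    using that by (simp add: cyclic_orderings_def quotient_def)
  then have "card (cyclically_ordered_set_partitions S) = (\<Sum>P | partition_on S P. card (cyclic_orderings P))"
    using assms P unfolding cyclically_ordered_set_partitions_def
    by (intro card_SigmaI) (auto intro: finitely_many_partition_on)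
  then show ?thesis
    using P by (simp add: card_cyclic_orderings)
qed

text \<open>Exactly one block contains \<open>x\<close>, so all blocks but one are ordered linearly.\<close>

lemma card_set_partitions_ordered_except:
  assumes "finite S" "x \<in> S"
  shows "card (set_partitions_ordered_except S x) = (\<Sum>P | partition_on S P. fact (card P - 1))"
proof -
  have P: "finite {B \<in> P. x \<notin> B}" "card {B \<in> P. x \<notin> B} = card P - 1" if "partition_on S P" for P
  proof -
    have fin: "finite P"
      using that assms finite_elements by blast
    then show "finite {B \<in> P. x \<notin> B}" by simp
    have part: "\<Union>P = S" "disjoint P"
      using that by (simp_all add: partition_on_def)
    then obtain C where C: "C \<in> P" "x \<in> C"
      using assms(2) by blast
    then have "{B \<in> P. x \<notin> B} = P - {C}"
      using disjointD[OF part(2)] by blast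
    then show "card {B \<in> P. x \<notin> B} = card P - 1"
      using C fin by simp
  qed
  have "finite {r. linear_order_on A r}" if "finite A" for A :: "'a set set"
    by (rule finite_subset[of _ "Pow (A \<times> A)"]) (use that in \<open>auto simp: order_on_defs\<close>)
  then have "card (set_partitions_ordered_except S x) =
      (\<Sum>P | partition_on S P. card {r. linear_order_on {B \<in> P. x \<notin> B} r})"
    using assms P unfolding set_partitions_ordered_except_def
    by (intro card_SigmaI) (auto intro: finitely_many_partition_on)
  then show ?thesis
    using P by (simp add: card_linear_orders)
qed

theorem theorem25:
  fixes k :: nat
  shows "v_half k = card (cyclically_ordered_set_partitions {1..k + 1})
       \<and> v_half k = card (set_partitions_ordered_except {1..k + 1} (k + 1))"
  by (simp add: v_half_eq_sum_partitions card_cyclically_ordered_set_partitions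
      card_set_partitions_ordered_except)

end
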